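(* Let $W$ be a finite complex reflection group, $\mathcal{A}$ its set of reflecting hyperplanes, $\mathcal{L}$ an admissible lattice of full reflection subgroups of $W$, and take the base ring $\mathbf{k}=\mathbb{C}$. Choose scalars $\lambda_H\in\mathbb{C}$, $H\in\mathcal{A}$, such that $\lambda_{w(H)}=\lambda_H$ for all $w\in W$. Then the 1-form $$\omega=\sum_{H\in\mathcal{A}}\left(\left(\lambda_H+\sum_{\mathrm{Ker}(s-1)=H}\mu_s s\right)-e_H\right)f_H\,\omega_H\ \in\ \Omega^1(X)\otimes Br^0(W,\mathcal{L})$$ is integrable and $W$-equivariant.
   Context: Let $W\subset \mathrm{GL}(V)$ be a finite complex reflection group ($V$ a finite-dimensional complex vector space), $\mathcal{R}$ its set of (pseudo-)reflections (nontrivial elements $s$ with $\mathrm{Ker}(s-1)$ a hyperplane), $\mathcal{A}=\{\mathrm{Ker}(s-1) : s\in\mathcal{R}\}$, and $H_s=\mathrm{Ker}(s-1)$. Sums over $s$ are over reflections. Let $X=V\setminus\bigcup_{H\in\mathcal{A}}H$, and $\omega_H=\frac{1}{\pi \mathrm{i}}\frac{\mathrm{d}\alpha_H}{\alpha_H}$ with $\alpha_H$ any linear form with kernel $H$. Two hyperplanes $H_1,H_2\in\mathcal{A}$ are transverse if $H_1\neq H_2$ and $\{H\in\mathcal{A} : H\supset H_1\cap H_2\}=\{H_1,H_2\}$. Scalars $\mu_s\in\mathbb{C}$, $s\in\mathcal{R}$, are fixed with $\mu_s=\mu_t$ whenever $s,t$ are conjugate in $W$. A reflection subgroup $G$ of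 $W$ is full if, whenever $s\in G$ is a reflection, $G$ contains all the reflections of $W$ with hyperplane $\mathrm{Ker}(s-1)$. An admissible lattice $\mathcal{L}$ is a collection of full reflection subgroups of $W$, stable under $W$-conjugation, forming a lattice under inclusion, and containing the trivial subgroup and all the cyclic full reflection subgroups $W_H=\{w\in W : w|_H=\mathrm{Id}\}$, $H\in\mathcal{A}$. Write $L_1\vee L_2$ for the join in $\mathcal{L}$ and $w(L)=wLw^{-1}$. We write $f_H$ for $f_{W_H}$. $Br^0(W,\mathcal{L})$ is the unital associative algebra with generators $w\in W$, $e_H$ ($H\in\mathcal{A}$), $f_L$ ($L\in\mathcal{L}$) and relations: - the multiplication relations of $W$; - $we_H=e_{w(H)}w$, and $wf_L=f_{w(L)}w$; - $e_{H_1}e_{H_2}=e_{H_2}e_{H_1}$ if $H_1,H_2$ are transverse; - if $H_1,H_2$ are distinct and not transverse, $e_{H_1}e_{H_2}=\left(\sum_{s\in\mathcal{R},\, s(H_2)=H_1}\mu_s s f_{H_s}\right)e_{H_2}=e_{H_1}\left(\sum_{s\in\mathcal{R},\, s(H_2)=H_1}\mu_s s f_{H_s}\right)$; - $e_Hf_L=f_Le_H$; - $e_Hf_H=f_He_H=e_H$; - $f_{L_1}f_{L_2}=f_{L_1\vee L_2}$, and $f_{\{1\}}=1$. For an algebra $A$ containing $W$ in its units (via a homomorphism), a form $\omega\in\Omega^1(X)\otimes A$ is integrable if $\mathrm{d}\omega+\omega\wedge\omega=0$ (for the logarithmic forms considered here, which are closed, this means $\omega\wedge\omega=0$), and $W$-equivariant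 if it is invariant under the diagonal action of $W$, acting on $\Omega^1(X)$ through its action on $X$ and on $A$ by conjugation. *)

theory Defs
  imports
    "HOL-Analysis.Analysis"
    "HOL-Library.Poly_Mapping"
    "HOL-Algebra.QuotRing"
    "HOL-Algebra.Generated_Groups"
    "HOL-Algebra.Lattice"
    "HOL-Algebra.Module"
begin

text \<open>
  Throughout, \<open>V\<close> is the type \<open>'v\<close> with scalar multiplication \<open>sc\<close> (finite-dimensionality is a
  hypothesis wherever it is needed), and groups of linear maps are sets of functions \<open>'v \<Rightarrow> 'v\<close>.
\<close>

section \<open>Complex reflection groups\<close>

definition GL :: "(complex \<Rightarrow> 'v::ab_group_add \<Rightarrow> 'v) \<Rightarrow> ('v \<Rightarrow> 'v) monoid" where
  "GL sc = \<lparr>carrier = {g. Vector_Spaces.linear sc sc g \<and> bij g}, monoid.mult = (\<circ>), one = id\<rparr>"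

definition Fix :: "('v \<Rightarrow> 'v) \<Rightarrow> 'v set" where
  "Fix s = {v. s v = v}"

text \<open>The condition on dimensions says that \<open>Ker (s - 1)\<close> has codimension one; it excludes the identity.\<close>
definition reflections ::
    "(complex \<Rightarrow> 'v::ab_group_add \<Rightarrow> 'v) \<Rightarrow> ('v \<Rightarrow> 'v) set \<Rightarrow> ('v \<Rightarrow> 'v) set" where
  "reflections sc W = {s \<in> W. vector_space.dim sc (Fix s) + 1 = vector_space.dim sc (UNIV :: 'v set)}"

definition reflection_subgroup ::
    "(complex \<Rightarrow> 'v::ab_group_add \<Rightarrow> 'v) \<Rightarrow> ('v \<Rightarrow> 'v) set \<Rightarrow> bool" where
  "reflection_subgroup sc G \<longleftrightarrow> subgroup G (GL sc) \<and> generate (GL sc) (reflections sc G) = G"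

definition complex_reflection_group ::
    "(complex \<Rightarrow> 'v::ab_group_add \<Rightarrow> 'v) \<Rightarrow> ('v \<Rightarrow> 'v) set \<Rightarrow> bool" where
  "complex_reflection_group sc W \<longleftrightarrow> finite W \<and> reflection_subgroup sc W"

definition hyperplanes ::
    "(complex \<Rightarrow> 'v::ab_group_add \<Rightarrow> 'v) \<Rightarrow> ('v \<Rightarrow> 'v) set \<Rightarrow> 'v set set" where
  "hyperplanes sc W = Fix ` reflections sc W"

definition hyp_complement ::
    "(complex \<Rightarrow> 'v::ab_group_add \<Rightarrow> 'v) \<Rightarrow> ('v \<Rightarrow> 'v) set \<Rightarrow> 'v set" where
  "hyp_complement sc W = UNIV - \<Union> (hyperplanes sc W)"

definition transverse ::
    "(complex \<Rightarrow> 'v::ab_group_add \<Rightarrow> 'v) \<Rightarrow> ('v \<Rightarrow> 'v) set \<Rightarrow> 'v set \<Rightarrow> 'v set \<Rightarrow> bool" where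
  "transverse sc W H1 H2 \<longleftrightarrow> H1 \<noteq> H2 \<and> {H \<in> hyperplanes sc W. H1 \<inter> H2 \<subseteq> H} = {H1, H2}"

definition conj_map :: "('v \<Rightarrow> 'v) \<Rightarrow> ('v \<Rightarrow> 'v) \<Rightarrow> 'v \<Rightarrow> 'v" where
  "conj_map w g = w \<circ> g \<circ> inv_into UNIV w"

definition hyp_stabilizer :: "('v \<Rightarrow> 'v) set \<Rightarrow> 'v set \<Rightarrow> ('v \<Rightarrow> 'v) set" where
  "hyp_stabilizer W H = {w \<in> W. \<forall>v\<in>H. w v = v}"

section \<open>Admissible lattices\<close>

definition full_reflection_subgroup ::
    "(complex \<Rightarrow> 'v::ab_group_add \<Rightarrow> 'v) \<Rightarrow> ('v \<Rightarrow> 'v) set \<Rightarrow> ('v \<Rightarrow> 'v) set \<Rightarrow> bool" where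
  "full_reflection_subgroup sc W G \<longleftrightarrow>
     G \<subseteq> W \<and> reflection_subgroup sc G \<and>
     (\<forall>s \<in> reflections sc G. \<forall>t \<in> reflections sc W. Fix t = Fix s \<longrightarrow> t \<in> G)"

definition inclusion_order :: "'a set set \<Rightarrow> 'a set gorder" where
  "inclusion_order \<L> = \<lparr>carrier = \<L>, eq = (=), le = (\<subseteq>)\<rparr>"

definition admissible_lattice ::
    "(complex \<Rightarrow> 'v::ab_group_add \<Rightarrow> 'v) \<Rightarrow> ('v \<Rightarrow> 'v) set \<Rightarrow> ('v \<Rightarrow> 'v) set set \<Rightarrow> bool" where
  "admissible_lattice sc W \<L> \<longleftrightarrow>
     (\<forall>L \<in> \<L>. full_reflection_subgroup sc W L) \<and>
     (\<forall>w \<in> W. \<forall>L \<in> \<L>. conj_map w ` L \<in> \<L>) \<and>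
     Lattice.lattice (inclusion_order \<L>) \<and>
     {id} \<in> \<L> \<and>
     (\<forall>H \<in> hyperplanes sc W. hyp_stabilizer W H \<in> \<L>)"

section \<open>Algebras given by generators and relations\<close>

text \<open>
  The free algebra on a set \<open>S\<close> is the monoid algebra of the free monoid on \<open>S\<close>.  The wrapper around
  lists carries the monoid structure written additively, so that the product of
  \<^typ>\<open>'a \<Rightarrow>\<^sub>0 complex\<close> is the convolution product.
\<close>
datatype 'g free_monoid = Word (letters: "'g list")

instantiation free_monoid :: (type) monoid_add
begin

definition zero_free_monoid :: "'a free_monoid" where
  "zero_free_monoid = Word []"

definition plus_free_monoid :: "'a free_monoid \<Rightarrow> 'a free_monoid \<Rightarrow> 'a free_monoid" where
  "plus_free_monoid u v = Word (letters u @ letters v)"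

instance
  by standard (simp_all add: zero_free_monoid_def plus_free_monoid_def)

end

type_synonym 'g free_poly = "'g free_monoid \<Rightarrow>\<^sub>0 complex"

definition const :: "complex \<Rightarrow> 'g free_poly" where
  "const c = Poly_Mapping.single 0 c"

definition var :: "'g \<Rightarrow> 'g free_poly" where
  "var g = Poly_Mapping.single (Word [g]) 1"

definition free_algebra :: "'g set \<Rightarrow> 'g free_poly ring" where
  "free_algebra S =
     \<lparr>carrier = {p. \<forall>u \<in> Poly_Mapping.keys p. set (letters u) \<subseteq> S},
      monoid.mult = (*), one = 1, ring.zero = 0, add = (+)\<rparr>"

text \<open>The class of \<open>p\<close> modulo the two-sided ideal generated by the relators \<open>Rel\<close>.\<close>
definition pres_class :: "'g set \<Rightarrow> 'g free_poly set \<Rightarrow> 'g free_poly \<Rightarrow> 'g free_poly set" where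
  "pres_class S Rel p = (Idl\<^bsub>free_algebra S\<^esub> Rel) +>\<^bsub>free_algebra S\<^esub> p"

text \<open>
  The quotient of the free algebra by that ideal.  The scalar \<open>c\<close> acts as multiplication by the class
  of the constant \<open>c\<close>.
\<close>
definition presented_algebra ::
    "'g set \<Rightarrow> 'g free_poly set \<Rightarrow> (complex, 'g free_poly set) module" where
  "presented_algebra S Rel =
     (let Q = free_algebra S Quot (Idl\<^bsub>free_algebra S\<^esub> Rel)
      in \<lparr>carrier = carrier Q, monoid.mult = monoid.mult Q, one = one Q,
          ring.zero = ring.zero Q, add = add Q,
          smult = (\<lambda>c a. pres_class S Rel (const c) \<otimes>\<^bsub>Q\<^esub> a)\<rparr>)"

section \<open>The algebra \<open>Br\<^sup>0(W, \<L>)\<close>\<close>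

datatype 'v br_gen = GenW "'v \<Rightarrow> 'v" | GenE "'v set" | GenF "('v \<Rightarrow> 'v) set"

abbreviation bw :: "('v \<Rightarrow> 'v) \<Rightarrow> 'v br_gen free_poly" where "bw w \<equiv> var (GenW w)"
abbreviation be :: "'v set \<Rightarrow> 'v br_gen free_poly" where "be H \<equiv> var (GenE H)"
abbreviation bf :: "('v \<Rightarrow> 'v) set \<Rightarrow> 'v br_gen free_poly" where "bf L \<equiv> var (GenF L)"

definition br_gens ::
    "(complex \<Rightarrow> 'v::ab_group_add \<Rightarrow> 'v) \<Rightarrow> ('v \<Rightarrow> 'v) set \<Rightarrow> ('v \<Rightarrow> 'v) set set \<Rightarrow> 'v br_gen set" where
  "br_gens sc W \<L> = GenW ` W \<union> GenE ` hyperplanes sc W \<union> GenF ` \<L>"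

definition br_refl_sum ::
    "(complex \<Rightarrow> 'v::ab_group_add \<Rightarrow> 'v) \<Rightarrow> ('v \<Rightarrow> 'v) set \<Rightarrow> (('v \<Rightarrow> 'v) \<Rightarrow> complex) \<Rightarrow>
     'v set \<Rightarrow> 'v set \<Rightarrow> 'v br_gen free_poly" where
  "br_refl_sum sc W \<mu> H1 H2 =
     (\<Sum>s \<in> {s \<in> reflections sc W. s ` H2 = H1}. const (\<mu> s) * bw s * bf (hyp_stabilizer W (Fix s)))"

text \<open>
  A defining relation \<open>p = q\<close> is recorded as the pair \<open>(p, q)\<close>.  The multiplication relations of \<open>W\<close>
  include the identification of the generator attached to the identity with the unit.
\<close>
inductive_set br_relations ::
    "(complex \<Rightarrow> 'v::ab_group_add \<Rightarrow> 'v) \<Rightarrow> ('v \<Rightarrow> 'v) set \<Rightarrow> ('v \<Rightarrow> 'v) set set \<Rightarrow>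
     (('v \<Rightarrow> 'v) \<Rightarrow> complex) \<Rightarrow> ('v br_gen free_poly \<times> 'v br_gen free_poly) set"
  for sc W \<L> \<mu>
  where
    mult_W: "\<lbrakk>w1 \<in> W; w2 \<in> W\<rbrakk> \<Longrightarrow> (bw w1 * bw w2, bw (w1 \<circ> w2)) \<in> br_relations sc W \<L> \<mu>"
  | one_W: "(bw id, 1) \<in> br_relations sc W \<L> \<mu>"
  | conj_e: "\<lbrakk>w \<in> W; H \<in> hyperplanes sc W\<rbrakk> \<Longrightarrow>
      (bw w * be H, be (w ` H) * bw w) \<in> br_relations sc W \<L> \<mu>"
  | conj_f: "\<lbrakk>w \<in> W; L \<in> \<L>\<rbrakk> \<Longrightarrow>
      (bw w * bf L, bf (conj_map w ` L) * bw w) \<in> br_relations sc W \<L> \<mu>"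
  | comm_e: "\<lbrakk>H1 \<in> hyperplanes sc W; H2 \<in> hyperplanes sc W; transverse sc W H1 H2\<rbrakk> \<Longrightarrow>
      (be H1 * be H2, be H2 * be H1) \<in> br_relations sc W \<L> \<mu>"
  | mult_e_left: "\<lbrakk>H1 \<in> hyperplanes sc W; H2 \<in> hyperplanes sc W; H1 \<noteq> H2; \<not> transverse sc W H1 H2\<rbrakk> \<Longrightarrow>
      (be H1 * be H2, br_refl_sum sc W \<mu> H1 H2 * be H2) \<in> br_relations sc W \<L> \<mu>"
  | mult_e_right: "\<lbrakk>H1 \<in> hyperplanes sc W; H2 \<in> hyperplanes sc W; H1 \<noteq> H2; \<not> transverse sc W H1 H2\<rbrakk> \<Longrightarrow>
      (be H1 * be H2, be H1 * br_refl_sum sc W \<mu> H1 H2) \<in> br_relations sc W \<L> \<mu>"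
  | comm_e_f: "\<lbrakk>H \<in> hyperplanes sc W; L \<in> \<L>\<rbrakk> \<Longrightarrow>
      (be H * bf L, bf L * be H) \<in> br_relations sc W \<L> \<mu>"
  | absorb_left: "H \<in> hyperplanes sc W \<Longrightarrow>
      (be H * bf (hyp_stabilizer W H), be H) \<in> br_relations sc W \<L> \<mu>"
  | absorb_right: "H \<in> hyperplanes sc W \<Longrightarrow>
      (bf (hyp_stabilizer W H) * be H, be H) \<in> br_relations sc W \<L> \<mu>"
  | mult_f: "\<lbrakk>L1 \<in> \<L>; L2 \<in> \<L>\<rbrakk> \<Longrightarrow>
      (bf L1 * bf L2, bf (L1 \<squnion>\<^bsub>inclusion_order \<L>\<^esub> L2)) \<in> br_relations sc W \<L> \<mu>"
  | one_f: "(bf {id}, 1) \<in> br_relations sc W \<L> \<mu>"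

definition br_relators ::
    "(complex \<Rightarrow> 'v::ab_group_add \<Rightarrow> 'v) \<Rightarrow> ('v \<Rightarrow> 'v) set \<Rightarrow> ('v \<Rightarrow> 'v) set set \<Rightarrow>
     (('v \<Rightarrow> 'v) \<Rightarrow> complex) \<Rightarrow> 'v br_gen free_poly set" where
  "br_relators sc W \<L> \<mu> = (\<lambda>(p, q). p - q) ` br_relations sc W \<L> \<mu>"

definition Br0 ::
    "(complex \<Rightarrow> 'v::ab_group_add \<Rightarrow> 'v) \<Rightarrow> ('v \<Rightarrow> 'v) set \<Rightarrow> ('v \<Rightarrow> 'v) set set \<Rightarrow>
     (('v \<Rightarrow> 'v) \<Rightarrow> complex) \<Rightarrow> (complex, 'v br_gen free_poly set) module" where
  "Br0 sc W \<L> \<mu> = presented_algebra (br_gens sc W \<L>) (br_relators sc W \<L> \<mu>)"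

definition br_class ::
    "(complex \<Rightarrow> 'v::ab_group_add \<Rightarrow> 'v) \<Rightarrow> ('v \<Rightarrow> 'v) set \<Rightarrow> ('v \<Rightarrow> 'v) set set \<Rightarrow>
     (('v \<Rightarrow> 'v) \<Rightarrow> complex) \<Rightarrow> 'v br_gen free_poly \<Rightarrow> 'v br_gen free_poly set" where
  "br_class sc W \<L> \<mu> p = pres_class (br_gens sc W \<L>) (br_relators sc W \<L> \<mu>) p"

section \<open>Differential forms with values in an algebra\<close>

text \<open>
  Holomorphic 1-forms on the complement \<open>X\<close> of finitely many hyperplanes, as functions
  \<open>\<eta> x v\<close> of a point \<open>x\<close> and a tangent vector \<open>v\<close>; values at points outside \<open>X\<close> are irrelevant.
  Holomorphy of \<open>x \<mapsto> \<eta> x v\<close> is complex differentiability along every complex line, which by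
  Hartogs' theorem is the usual notion since \<open>V\<close> is finite-dimensional.
\<close>
definition forms1 ::
    "(complex \<Rightarrow> 'v::ab_group_add \<Rightarrow> 'v) \<Rightarrow> 'v set \<Rightarrow> ('v \<Rightarrow> 'v \<Rightarrow> complex) set" where
  "forms1 sc X =
     {\<eta>. \<forall>x \<in> X. Vector_Spaces.linear sc (*) (\<eta> x) \<and>
          (\<forall>u v. (\<lambda>t. \<eta> (x + sc t u) v) field_differentiable (at 0))}"

text \<open>\<open>d\<eta>(u, v) = \<partial>\<^sub>u \<eta>(v) - \<partial>\<^sub>v \<eta>(u)\<close> for constant vector fields \<open>u, v\<close>.\<close>
definition ext_d ::
    "(complex \<Rightarrow> 'v::ab_group_add \<Rightarrow> 'v) \<Rightarrow> ('v \<Rightarrow> 'v \<Rightarrow> complex) \<Rightarrow> 'v \<Rightarrow> 'v \<Rightarrow> 'v \<Rightarrow> complex" where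
  "ext_d sc \<eta> x u v = deriv (\<lambda>t. \<eta> (x + sc t u) v) 0 - deriv (\<lambda>t. \<eta> (x + sc t v) u) 0"

text \<open>
  Elements of \<open>\<Omega>\<^sup>1(X) \<otimes> A\<close> and of \<open>\<Omega>\<^sup>2(X) \<otimes> A\<close> are identified with the \<open>A\<close>-valued functions they
  define; this is faithful, because the tensor product of a space of scalar functions with a vector
  space \<open>A\<close> embeds in the space of \<open>A\<close>-valued functions.  The following says that \<open>\<omega>\<close> is
  \<open>\<Sum>\<^sub>i \<eta>\<^sub>i \<otimes> a\<^sub>i\<close>.
\<close>
definition is_tensor_sum ::
    "(complex \<Rightarrow> 'v::ab_group_add \<Rightarrow> 'v) \<Rightarrow> 'v set \<Rightarrow> (complex, 'a) module \<Rightarrow>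
     nat \<Rightarrow> (nat \<Rightarrow> 'v \<Rightarrow> 'v \<Rightarrow> complex) \<Rightarrow> (nat \<Rightarrow> 'a) \<Rightarrow> ('v \<Rightarrow> 'v \<Rightarrow> 'a) \<Rightarrow> bool" where
  "is_tensor_sum sc X A n \<eta> a \<omega> \<longleftrightarrow>
     (\<forall>i<n. \<eta> i \<in> forms1 sc X \<and> a i \<in> carrier A) \<and>
     (\<forall>x \<in> X. \<forall>v. \<omega> x v = (\<Oplus>\<^bsub>A\<^esub>i\<in>{..<n}. \<eta> i x v \<odot>\<^bsub>A\<^esub> a i))"

definition forms1_tensor ::
    "(complex \<Rightarrow> 'v::ab_group_add \<Rightarrow> 'v) \<Rightarrow> 'v set \<Rightarrow> (complex, 'a) module \<Rightarrow> ('v \<Rightarrow> 'v \<Rightarrow> 'a) set" where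
  "forms1_tensor sc X A = {\<omega>. \<exists>n \<eta> a. is_tensor_sum sc X A n \<eta> a \<omega>}"

text \<open>
  \<open>\<tau> = d\<omega>\<close> for \<open>\<omega> = \<Sum>\<^sub>i \<eta>\<^sub>i \<otimes> a\<^sub>i\<close>, where \<open>d\<omega> = \<Sum>\<^sub>i d\<eta>\<^sub>i \<otimes> a\<^sub>i\<close> does not depend on the chosen
  expression of \<open>\<omega>\<close>.
\<close>
definition has_ext_d ::
    "(complex \<Rightarrow> 'v::ab_group_add \<Rightarrow> 'v) \<Rightarrow> 'v set \<Rightarrow> (complex, 'a) module \<Rightarrow>
     ('v \<Rightarrow> 'v \<Rightarrow> 'a) \<Rightarrow> ('v \<Rightarrow> 'v \<Rightarrow> 'v \<Rightarrow> 'a) \<Rightarrow> bool" where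
  "has_ext_d sc X A \<omega> \<tau> \<longleftrightarrow>
     (\<exists>n \<eta> a. is_tensor_sum sc X A n \<eta> a \<omega> \<and>
        (\<forall>x \<in> X. \<forall>u v. \<tau> x u v = (\<Oplus>\<^bsub>A\<^esub>i\<in>{..<n}. ext_d sc (\<eta> i) x u v \<odot>\<^bsub>A\<^esub> a i)))"

text \<open>The product \<open>(\<eta> \<otimes> a) \<and> (\<eta>' \<otimes> a') = (\<eta> \<and> \<eta>') \<otimes> a a'\<close>, evaluated on tangent vectors \<open>u, v\<close>.\<close>
definition wedge ::
    "(complex, 'a) module \<Rightarrow> ('v \<Rightarrow> 'v \<Rightarrow> 'a) \<Rightarrow> ('v \<Rightarrow> 'v \<Rightarrow> 'a) \<Rightarrow> 'v \<Rightarrow> 'v \<Rightarrow> 'v \<Rightarrow> 'a" where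
  "wedge A \<omega> \<omega>' x u v = (\<omega> x u \<otimes>\<^bsub>A\<^esub> \<omega>' x v) \<ominus>\<^bsub>A\<^esub> (\<omega> x v \<otimes>\<^bsub>A\<^esub> \<omega>' x u)"

definition integrable_form ::
    "(complex \<Rightarrow> 'v::ab_group_add \<Rightarrow> 'v) \<Rightarrow> 'v set \<Rightarrow> (complex, 'a) module \<Rightarrow> ('v \<Rightarrow> 'v \<Rightarrow> 'a) \<Rightarrow> bool" where
  "integrable_form sc X A \<omega> \<longleftrightarrow>
     (\<exists>\<tau>. has_ext_d sc X A \<omega> \<tau> \<and>
        (\<forall>x \<in> X. \<forall>u v. \<tau> x u v \<oplus>\<^bsub>A\<^esub> wedge A \<omega> \<omega> x u v = \<zero>\<^bsub>A\<^esub>))"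

text \<open>
  The diagonal action \<open>w \<cdot> (\<eta> \<otimes> a) = (w\<^sup>-\<^sup>1)\<^sup>*\<eta> \<otimes> \<iota>(w) a \<iota>(w)\<^sup>-\<^sup>1\<close>, where \<open>\<iota>\<close> is the homomorphism from
  \<open>W\<close> to the units of \<open>A\<close>; the differential of the linear map \<open>w\<^sup>-\<^sup>1\<close> is \<open>w\<^sup>-\<^sup>1\<close> itself.
\<close>
definition diag_action ::
    "(complex, 'a) module \<Rightarrow> (('v \<Rightarrow> 'v) \<Rightarrow> 'a) \<Rightarrow> ('v \<Rightarrow> 'v) \<Rightarrow> ('v \<Rightarrow> 'v \<Rightarrow> 'a) \<Rightarrow> 'v \<Rightarrow> 'v \<Rightarrow> 'a" where
  "diag_action A \<iota> w \<omega> x v =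
     \<iota> w \<otimes>\<^bsub>A\<^esub> \<omega> (inv_into UNIV w x) (inv_into UNIV w v) \<otimes>\<^bsub>A\<^esub> inv\<^bsub>A\<^esub> (\<iota> w)"

definition equivariant_form ::
    "('v \<Rightarrow> 'v) set \<Rightarrow> 'v set \<Rightarrow> (complex, 'a) module \<Rightarrow> (('v \<Rightarrow> 'v) \<Rightarrow> 'a) \<Rightarrow>
     ('v \<Rightarrow> 'v \<Rightarrow> 'a) \<Rightarrow> bool" where
  "equivariant_form W X A \<iota> \<omega> \<longleftrightarrow>
     (\<forall>w \<in> W. \<forall>x \<in> X. \<forall>v. diag_action A \<iota> w \<omega> x v = \<omega> x v)"

section \<open>The connection form\<close>

text \<open>\<open>(1 / \<pi>\<i>) d\<alpha> / \<alpha>\<close> for a linear form \<open>\<alpha>\<close>, whose differential at every point is \<open>\<alpha>\<close>.\<close>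
definition log_form :: "('v \<Rightarrow> complex) \<Rightarrow> 'v \<Rightarrow> 'v \<Rightarrow> complex" where
  "log_form \<alpha> x v = 1 / (complex_of_real pi * \<i>) * (\<alpha> v / \<alpha> x)"

definition br_form ::
    "(complex \<Rightarrow> 'v::ab_group_add \<Rightarrow> 'v) \<Rightarrow> ('v \<Rightarrow> 'v) set \<Rightarrow> ('v \<Rightarrow> 'v) set set \<Rightarrow>
     (('v \<Rightarrow> 'v) \<Rightarrow> complex) \<Rightarrow> ('v set \<Rightarrow> complex) \<Rightarrow> ('v set \<Rightarrow> 'v \<Rightarrow> complex) \<Rightarrow>
     'v \<Rightarrow> 'v \<Rightarrow> 'v br_gen free_poly set" where
  "br_form sc W \<L> \<mu> lam \<alpha> x v =
     (\<Oplus>\<^bsub>Br0 sc W \<L> \<mu>\<^esub>H\<in>hyperplanes sc W.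
        log_form (\<alpha> H) x v \<odot>\<^bsub>Br0 sc W \<L> \<mu>\<^esub>
        br_class sc W \<L> \<mu>
          (((const (lam H) + (\<Sum>s \<in> {s \<in> reflections sc W. Fix s = H}. const (\<mu> s) * bw s)) - be H)
           * bf (hyp_stabilizer W H)))"

end

theory Submission
  imports Defs
begin

text \<open>
  Let \<open>t\<^sub>H\<close> be the coefficient of \<open>\<omega>\<^sub>H\<close>.  Conjugation by \<open>w\<close> takes \<open>t\<^sub>H\<close> to the coefficient of
  \<open>w(H)\<close>, which is equivariance.  The forms \<open>\<omega>\<^sub>H\<close> are closed, so integrability means
  \<open>\<omega> \<and> \<omega> = 0\<close>.  Group the products \<open>t\<^sub>H t\<^sub>K\<close> by \<open>Z = H \<inter> K\<close>.  At a fixed point, and on fixed tangent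
  vectors, the coefficient of \<open>t\<^sub>H t\<^sub>K\<close> with \<open>H, K \<supseteq> Z\<close> has the form \<open>D (p\<^sub>K - p\<^sub>H)\<close>, because the linear
  forms through \<open>Z\<close> span a plane.  Hence the part over \<open>Z\<close> is \<open>D \<Sum>\<^sub>K p\<^sub>K [T, t\<^sub>K]\<close> where \<open>T\<close> is the sum
  of the \<open>t\<^sub>H\<close> with \<open>H \<supseteq> Z\<close>.  Finally \<open>T\<close> commutes with \<open>f\<^sub>K\<close>, with \<open>e\<^sub>K\<close> and with every reflection
  whose hyperplane contains \<open>Z\<close>, hence with \<open>t\<^sub>K\<close>.
\<close>

section \<open>Presented algebras\<close>

lemma const_diff: "const (a - b) = const a - const b"
  by (simp add: const_def single_diff)

lemma const_mult: "const (a * b) = const a * const b"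
  by (simp add: const_def mult_single)

lemma const_0 [simp]: "const 0 = 0"
  by (simp add: const_def)

lemma const_1 [simp]: "const 1 = 1"
  by (simp add: const_def)

text \<open>A constant sits at the empty word, which is neutral on both sides, and complex
  coefficients commute. Centrality is therefore clear on monomials, and the induction adds one
  monomial at a time.\<close>

lemma const_commute: "p * const c = const c * p"
proof (induction p rule: update_induct)
  case const
  have "Poly_Mapping.single k (v :: complex) * const c = const c * Poly_Mapping.single k v"
    for k :: "'a free_monoid" and v
    by (simp add: const_def mult_single mult.commute)
  then show ?case by simp
next
  case (update f a b)
  \<comment> \<open>The key \<open>a\<close> is new to \<open>f\<close>, so updating there is the
    same as adding a monomial.\<close>
  have "Poly_Mapping.update a b f = f + Poly_Mapping.single a b"
    using update(1)
    by (intro poly_mapping_eqI) (auto simp: lookup_update lookup_add lookup_single in_keys_iff when_def)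
  moreover have "Poly_Mapping.single a b * const c = const c * Poly_Mapping.single a b"
    by (simp add: const_def mult_single mult.commute)
  ultimately show ?case
    using update(3) by (simp add: distrib_left distrib_right)
qed

lemma const_left_commute: "p * (const c * q) = const c * (p * q)"
  by (metis const_commute mult.assoc)

lemma const_mult_const_mult: "(const a * p) * (const b * q) = const (a * b) * (p * q)"
  by (simp only: mult.assoc const_left_commute[of p] const_mult)

section \<open>The free algebra as a ring\<close>

abbreviation free_carrier :: "'g set \<Rightarrow> 'g free_poly set" where
  "free_carrier S \<equiv> carrier (free_algebra S)"

lemma free_carrier_iff: "p \<in> free_carrier S \<longleftrightarrow> (\<forall>u \<in> Poly_Mapping.keys p. set (letters u) \<subseteq> S)"
  by (simp add: free_algebra_def)

lemma free_algebra_sel [simp]: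
  "monoid.mult (free_algebra S) = (*)" "one (free_algebra S) = 1"
  "ring.zero (free_algebra S) = 0" "add (free_algebra S) = (+)"
  by (simp_all add: free_algebra_def)

lemma free_carrier_0 [simp]: "0 \<in> free_carrier S"
  by (simp add: free_carrier_iff)

lemma free_carrier_const [simp]: "const c \<in> free_carrier S"
  by (simp add: free_carrier_iff const_def zero_free_monoid_def)

lemma free_carrier_1 [simp]: "1 \<in> free_carrier S"
  using free_carrier_const[of 1] by simp

lemma free_carrier_var [simp]: "g \<in> S \<Longrightarrow> var g \<in> free_carrier S"
  by (simp add: free_carrier_iff var_def)

lemma free_carrier_add [simp]: "p \<in> free_carrier S \<Longrightarrow> q \<in> free_carrier S \<Longrightarrow> p + q \<in> free_carrier S"
  using keys_add[of p q] by (fastforce simp: free_carrier_iff)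

lemma free_carrier_uminus [simp]: "p \<in> free_carrier S \<Longrightarrow> - p \<in> free_carrier S"
  by (simp add: free_carrier_iff)

lemma free_carrier_diff [simp]: "p \<in> free_carrier S \<Longrightarrow> q \<in> free_carrier S \<Longrightarrow> p - q \<in> free_carrier S"
  using free_carrier_add[of p S "- q"] by simp

lemma free_carrier_mult [simp]: "p \<in> free_carrier S \<Longrightarrow> q \<in> free_carrier S \<Longrightarrow> p * q \<in> free_carrier S"
  using keys_mult[of p q] by (fastforce simp: free_carrier_iff plus_free_monoid_def)

lemma free_carrier_sum [simp]:
  "(\<And>i. i \<in> I \<Longrightarrow> f i \<in> free_carrier S) \<Longrightarrow> sum f I \<in> free_carrier S"
  by (induction I rule: infinite_finite_induct) auto

lemma ring_free_algebra: "ring (free_algebra S)"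
proof (rule ringI)
  show "abelian_group (free_algebra S)"
  proof (rule abelian_groupI)
    fix x assume "x \<in> free_carrier S"
    then show "\<exists>y\<in>free_carrier S. y \<oplus>\<^bsub>free_algebra S\<^esub> x = \<zero>\<^bsub>free_algebra S\<^esub>"
      by (intro bexI[of _ "- x"]) auto
  qed (auto simp: add_ac)
  show "Group.monoid (free_algebra S)"
    by (rule monoidI) (auto simp: mult.assoc)
qed (auto simp: distrib_left distrib_right)

section \<open>The quotient of a free algebra by a set of relators\<close>

locale presentation =
  fixes S :: "'g set" and Rel :: "'g free_poly set"
  assumes Rel: "Rel \<subseteq> free_carrier S"
begin

sublocale F: ring "free_algebra S" by (rule ring_free_algebra)
sublocale I: ideal "Idl\<^bsub>free_algebra S\<^esub> Rel" "free_algebra S"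
  by (rule F.genideal_ideal[OF Rel])

lemma presented_algebra_sel:
  defines "Q \<equiv> free_algebra S Quot (Idl\<^bsub>free_algebra S\<^esub> Rel)"
  shows "carrier (presented_algebra S Rel) = carrier Q"
    "monoid.mult (presented_algebra S Rel) = monoid.mult Q"
    "one (presented_algebra S Rel) = one Q"
    "ring.zero (presented_algebra S Rel) = ring.zero Q"
    "add (presented_algebra S Rel) = add Q"
    "c \<odot>\<^bsub>presented_algebra S Rel\<^esub> a = pres_class S Rel (const c) \<otimes>\<^bsub>presented_algebra S Rel\<^esub> a"
  by (simp_all add: presented_algebra_def Q_def Let_def)

text \<open>The module record is a different object from the quotient ring with the same five ring
  components, so the axioms are carried over component by component.\<close>

lemma ring_presented_algebra: "ring (presented_algebra S Rel)"
proof -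
  define Q where "Q = free_algebra S Quot (Idl\<^bsub>free_algebra S\<^esub> Rel)"
  note sel = presented_algebra_sel(1-5)[folded Q_def]
  interpret Q: ring Q unfolding Q_def by (rule I.quotient_is_ring)
  show ?thesis
  proof (rule ringI)
    show "abelian_group (presented_algebra S Rel)"
      by (rule abelian_groupI)
         (auto simp: sel Q.a_ac intro: abelian_groupE(6)[OF Q.abelian_group_axioms])
    show "Group.monoid (presented_algebra S Rel)"
      by (rule monoidI) (auto simp: sel Q.m_assoc)
  qed (auto simp: sel Q.l_distr Q.r_distr)
qed

lemma pres_class_ring_hom: "pres_class S Rel \<in> ring_hom (free_algebra S) (presented_algebra S Rel)"
  using I.rcos_ring_hom unfolding ring_hom_def pres_class_def[abs_def]
  by (auto simp: presented_algebra_sel)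

lemma pres_class_eqI:
  assumes "p \<in> free_carrier S" "q \<in> free_carrier S" "p - q \<in> Rel"
  shows "pres_class S Rel p = pres_class S Rel q"
proof -
  have "p - q \<in> Idl\<^bsub>free_algebra S\<^esub> Rel"
    using F.genideal_self[OF Rel] assms by auto
  then have "p \<in> Idl\<^bsub>free_algebra S\<^esub> Rel +>\<^bsub>free_algebra S\<^esub> q"
    by (force simp: a_r_coset_def')
  then show ?thesis
    unfolding pres_class_def using F.a_repr_independence I.a_subgroup assms
    by (metis I.is_additive_subgroup additive_subgroup.a_subgroup)
qed

abbreviation "P \<equiv> presented_algebra S Rel"
abbreviation "cl \<equiv> pres_class S Rel"

sublocale P: ring P by (rule ring_presented_algebra)

lemma cl_closed [simp]: "p \<in> free_carrier S \<Longrightarrow> cl p \<in> carrier P"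
  by (rule ring_hom_closed[OF pres_class_ring_hom])

lemma cl_mult: "p \<in> free_carrier S \<Longrightarrow> q \<in> free_carrier S \<Longrightarrow> cl (p * q) = cl p \<otimes>\<^bsub>P\<^esub> cl q"
  using ring_hom_mult[OF pres_class_ring_hom, of p q] by simp

lemma cl_add: "p \<in> free_carrier S \<Longrightarrow> q \<in> free_carrier S \<Longrightarrow> cl (p + q) = cl p \<oplus>\<^bsub>P\<^esub> cl q"
  using ring_hom_add[OF pres_class_ring_hom, of p q] by simp

lemma cl_1: "cl 1 = \<one>\<^bsub>P\<^esub>"
  using ring_hom_one[OF pres_class_ring_hom] by simp

lemma cl_0: "cl 0 = \<zero>\<^bsub>P\<^esub>"
  using ring_hom_zero[OF pres_class_ring_hom F.ring_axioms P.ring_axioms] by simp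

lemma cl_uminus: "p \<in> free_carrier S \<Longrightarrow> cl (- p) = \<ominus>\<^bsub>P\<^esub> cl p"
  using cl_add[of "- p" p] cl_0 by (intro P.minus_equality[symmetric]) auto

lemma cl_diff:
  "p \<in> free_carrier S \<Longrightarrow> q \<in> free_carrier S \<Longrightarrow> cl (p - q) = cl p \<ominus>\<^bsub>P\<^esub> cl q"
  using cl_add[of p "- q"] by (simp add: cl_uminus a_minus_def)

lemma cl_sum:
  assumes "finite J" "\<And>i. i \<in> J \<Longrightarrow> f i \<in> free_carrier S"
  shows "cl (sum f J) = (\<Oplus>\<^bsub>P\<^esub>i\<in>J. cl (f i))"
  using assms
proof (induction J rule: finite_induct)
  case (insert i J)
  have "(\<Oplus>\<^bsub>P\<^esub>i\<in>insert i J. cl (f i)) = cl (f i) \<oplus>\<^bsub>P\<^esub> (\<Oplus>\<^bsub>P\<^esub>i\<in>J. cl (f i))"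
    using insert by (intro P.finsum_insert) auto
  then show ?case using insert by (simp add: cl_add)
qed (simp add: cl_0)

lemma cl_smult:
  "p \<in> free_carrier S \<Longrightarrow> c \<odot>\<^bsub>P\<^esub> cl p = cl (const c * p)"
  by (simp add: presented_algebra_sel(6) cl_mult)

text \<open>Calculations run on representatives in the free algebra, with the ordinary ring
  operations. Membership in the carrier is part of the relation because the homomorphism laws of
  \<open>cl\<close> are stated only there; a chain of congruences then carries its own side
  conditions.\<close>

definition cong :: "'g free_poly \<Rightarrow> 'g free_poly \<Rightarrow> bool" (infix "\<doteq>" 50) where
  "p \<doteq> q \<longleftrightarrow> p \<in> free_carrier S \<and> q \<in> free_carrier S \<and> cl p = cl q"

lemma cong_refl [simp, intro]: "p \<in> free_carrier S \<Longrightarrow> p \<doteq> p"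
  by (simp add: cong_def)

lemma cong_sym: "p \<doteq> q \<Longrightarrow> q \<doteq> p"
  by (simp add: cong_def)

lemma cong_trans [trans]: "p \<doteq> q \<Longrightarrow> q \<doteq> r \<Longrightarrow> p \<doteq> r"
  by (simp add: cong_def)

lemma eq_cong_trans [trans]: "p = q \<Longrightarrow> q \<doteq> r \<Longrightarrow> p \<doteq> r"
  and cong_eq_trans [trans]: "p \<doteq> q \<Longrightarrow> q = r \<Longrightarrow> p \<doteq> r"
  by simp_all

lemma cong_carrier: "p \<doteq> q \<Longrightarrow> p \<in> free_carrier S" "p \<doteq> q \<Longrightarrow> q \<in> free_carrier S"
  by (simp_all add: cong_def)

lemma cong_add: "p \<doteq> p' \<Longrightarrow> q \<doteq> q' \<Longrightarrow> p + q \<doteq> p' + q'"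
  by (simp add: cong_def cl_add)

lemma cong_diff: "p \<doteq> p' \<Longrightarrow> q \<doteq> q' \<Longrightarrow> p - q \<doteq> p' - q'"
  by (simp add: cong_def cl_diff)

lemma cong_mult: "p \<doteq> p' \<Longrightarrow> q \<doteq> q' \<Longrightarrow> p * q \<doteq> p' * q'"
  by (simp add: cong_def cl_mult)

lemma cong_mult_left: "p \<doteq> p' \<Longrightarrow> q \<in> free_carrier S \<Longrightarrow> p * q \<doteq> p' * q"
  and cong_mult_right: "p \<doteq> p' \<Longrightarrow> q \<in> free_carrier S \<Longrightarrow> q * p \<doteq> q * p'"
  by (simp_all add: cong_mult)

lemma cong_sum: "(\<And>i. i \<in> J \<Longrightarrow> f i \<doteq> g i) \<Longrightarrow> sum f J \<doteq> sum g J"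
  by (induction J rule: infinite_finite_induct) (auto intro: cong_add)

lemma cong_diff_0: "p - q \<doteq> 0 \<Longrightarrow> q \<in> free_carrier S \<Longrightarrow> p \<doteq> q"
  using cong_add[of "p - q" 0 q q] by simp

lemma cong_rel: "p - q \<in> Rel \<Longrightarrow> p \<in> free_carrier S \<Longrightarrow> q \<in> free_carrier S \<Longrightarrow> p \<doteq> q"
  by (simp add: cong_def pres_class_eqI)

text \<open>Commutation in the quotient, stated on representatives. The closure rules below make the
  centralizer of a class a subalgebra, so commutation with a compound element reduces to its
  building blocks.\<close>

definition commutes :: "'g free_poly \<Rightarrow> 'g free_poly \<Rightarrow> bool" where
  "commutes p q \<longleftrightarrow> p \<in> free_carrier S \<and> q \<in> free_carrier S \<and> p * q \<doteq> q * p"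

lemma commutes_sym: "commutes p q \<Longrightarrow> commutes q p"
  by (auto simp: commutes_def intro: cong_sym)

lemma commutes_diff_0: "commutes p q \<Longrightarrow> p * q - q * p \<doteq> 0"
  using cong_diff[of "p * q" "q * p" "q * p" "q * p"] by (auto simp: commutes_def)

lemma commutesI: "p * q - q * p \<doteq> 0 \<Longrightarrow> p \<in> free_carrier S \<Longrightarrow> q \<in> free_carrier S \<Longrightarrow> commutes p q"
  unfolding commutes_def by (auto intro: cong_diff_0)

lemma commutes_add: "commutes p a \<Longrightarrow> commutes p b \<Longrightarrow> commutes p (a + b)"
  by (auto simp: commutes_def distrib_left distrib_right intro: cong_add)

lemma commutes_diff: "commutes p a \<Longrightarrow> commutes p b \<Longrightarrow> commutes p (a - b)"
  by (auto simp: commutes_def right_diff_distrib left_diff_distrib intro: cong_diff)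

lemma commutes_mult:
  assumes "commutes p a" "commutes p b"
  shows "commutes p (a * b)"
proof -
  have "p * (a * b) \<doteq> a * p * b"
    using assms by (auto simp: commutes_def mult.assoc[symmetric] intro: cong_mult)
  also have "a * p * b \<doteq> a * b * p"
    using assms by (auto simp: commutes_def mult.assoc intro: cong_mult)
  finally show ?thesis using assms by (simp add: commutes_def)
qed

lemma commutes_const: "p \<in> free_carrier S \<Longrightarrow> commutes p (const c)"
  by (simp add: commutes_def const_commute)

lemma commutes_sum:
  "p \<in> free_carrier S \<Longrightarrow> (\<And>i. i \<in> J \<Longrightarrow> commutes p (f i)) \<Longrightarrow> commutes p (sum f J)"
  by (induction J rule: infinite_finite_induct)
     (use commutes_const[of p 0] in \<open>auto intro: commutes_add\<close>)

lemma commutes_cong: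
  assumes "commutes p a" "a \<doteq> b"
  shows "commutes p b"
proof -
  have p: "p \<in> free_carrier S" using assms(1) by (simp add: commutes_def)
  have "p * b \<doteq> p * a" using assms(2) p by (intro cong_mult) (auto intro: cong_sym)
  also have "p * a \<doteq> a * p" using assms(1) by (simp add: commutes_def)
  also have "a * p \<doteq> b * p" using assms(2) p by (intro cong_mult) auto
  finally show ?thesis using p assms(2) cong_carrier by (simp add: commutes_def)
qed

end

section \<open>Hyperplanes of linear groups\<close>

context vector_space
begin

text \<open>A vector \<open>y\<close> outside the kernel of \<open>\<alpha>\<close> splits the space
  into that kernel and a line. Since \<open>\<gamma>\<close> vanishes on the kernel, its value at
  \<open>y\<close> determines the constant.\<close>

lemma linear_form_dependent:
  assumes "Vector_Spaces.linear scale (*) \<alpha>" "Vector_Spaces.linear scale (*) \<gamma>"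
    and "\<And>v. \<alpha> v = 0 \<Longrightarrow> \<gamma> v = 0"
  obtains c where "\<And>v. \<gamma> v = c * \<alpha> v"
proof (cases "\<forall>v. \<alpha> v = 0")
  case True
  then show ?thesis using assms(3) that[of 0] by simp
next
  case False
  interpret A: Vector_Spaces.linear scale "(*)" \<alpha> by fact
  interpret C: Vector_Spaces.linear scale "(*)" \<gamma> by fact
  obtain y where y: "\<alpha> y \<noteq> 0" using False by blast
  have "\<gamma> v = \<gamma> y / \<alpha> y * \<alpha> v" for v
  proof -
    have "\<alpha> (v - scale (\<alpha> v / \<alpha> y) y) = 0"
      using y by (simp add: A.diff A.scale)
    then have "\<gamma> (v - scale (\<alpha> v / \<alpha> y) y) = 0" by (rule assms(3))
    then show ?thesis by (simp add: C.diff C.scale)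
  qed
  then show ?thesis by (rule that)
qed

text \<open>Subtracting a multiple of \<open>\<beta>\<close> from \<open>\<gamma>\<close> reduces to
  the case of one form. The multiple is read off at a vector of the kernel of
  \<open>\<alpha>\<close> where \<open>\<beta>\<close> does not vanish; if there is none,
  \<open>\<gamma>\<close> already vanishes on the kernel of \<open>\<alpha>\<close>.\<close>

lemma linear_form_dependent2:
  assumes \<alpha>: "Vector_Spaces.linear scale (*) \<alpha>" and \<beta>: "Vector_Spaces.linear scale (*) \<beta>"
    and \<gamma>: "Vector_Spaces.linear scale (*) \<gamma>"
    and "\<And>v. \<alpha> v = 0 \<Longrightarrow> \<beta> v = 0 \<Longrightarrow> \<gamma> v = 0"
  obtains a b where "\<And>v. \<gamma> v = a * \<alpha> v + b * \<beta> v"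
proof (cases "\<forall>v. \<alpha> v = 0 \<longrightarrow> \<beta> v = 0")
  case True
  then obtain c where "\<And>v. \<gamma> v = c * \<alpha> v"
    using linear_form_dependent[OF \<alpha> \<gamma>] assms(4) by blast
  then show ?thesis using that[of c 0] by simp
next
  case False
  interpret A: Vector_Spaces.linear scale "(*)" \<alpha> by fact
  interpret B: Vector_Spaces.linear scale "(*)" \<beta> by fact
  interpret C: Vector_Spaces.linear scale "(*)" \<gamma> by fact
  obtain y where y: "\<alpha> y = 0" "\<beta> y \<noteq> 0" using False by blast
  define b where "b = \<gamma> y / \<beta> y"
  have lin: "Vector_Spaces.linear scale (*) (\<lambda>v. \<gamma> v - b * \<beta> v)"
    by unfold_locales (simp_all add: B.add C.add B.scale C.scale algebra_simps)
  have "\<gamma> v - b * \<beta> v = 0" if "\<alpha> v = 0" for v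
  proof -
    have "\<gamma> (v - scale (\<beta> v / \<beta> y) y) = 0"
      using y that by (intro assms(4)) (simp_all add: A.diff A.scale B.diff B.scale)
    then show ?thesis by (simp add: C.diff C.scale b_def)
  qed
  then obtain a where "\<And>v. \<gamma> v - b * \<beta> v = a * \<alpha> v"
    using linear_form_dependent[OF \<alpha> lin] by blast
  then have "\<And>v. \<gamma> v = a * \<alpha> v + b * \<beta> v"
    by (metis diff_add_cancel)
  then show ?thesis by (rule that)
qed

end

section \<open>The general linear group\<close>

lemma group_GL:
  fixes sc :: "complex \<Rightarrow> 'v::ab_group_add \<Rightarrow> 'v"
  assumes "vector_space sc"
  shows "group (GL sc)"
proof (rule groupI)
  interpret vector_space sc by fact
  fix g assume g: "g \<in> carrier (GL sc)"
  then interpret g: Vector_Spaces.linear sc sc g by (simp add: GL_def)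
  have bij: "bij g" using g by (simp add: GL_def)
  have "Vector_Spaces.linear sc sc (inv_into UNIV g)"
  proof unfold_locales
    show "inv_into UNIV g (b1 + b2) = inv_into UNIV g b1 + inv_into UNIV g b2" for b1 b2
      using bij by (intro inv_f_eq) (simp_all add: g.add bij_is_inj bij_is_surj surj_f_inv_f)
    show "inv_into UNIV g (sc r b) = sc r (inv_into UNIV g b)" for r b
      using bij by (intro inv_f_eq) (simp_all add: g.scale bij_is_inj bij_is_surj surj_f_inv_f)
  qed
  then have "inv_into UNIV g \<in> carrier (GL sc)" using bij by (simp add: GL_def bij_imp_bij_inv)
  moreover have "inv_into UNIV g \<otimes>\<^bsub>GL sc\<^esub> g = \<one>\<^bsub>GL sc\<^esub>"
    using bij by (simp add: GL_def bij_is_inj)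
  ultimately show "\<exists>y\<in>carrier (GL sc). y \<otimes>\<^bsub>GL sc\<^esub> g = \<one>\<^bsub>GL sc\<^esub>" by blast
next
  interpret vector_space sc by fact
  show "\<one>\<^bsub>GL sc\<^esub> \<in> carrier (GL sc)"
    using linear_id by (simp add: GL_def id_def bij_def surj_def)
next
  interpret vector_space_pair sc sc by (simp add: vector_space_pair_def assms)
  fix x y assume "x \<in> carrier (GL sc)" "y \<in> carrier (GL sc)"
  then show "x \<otimes>\<^bsub>GL sc\<^esub> y \<in> carrier (GL sc)"
    by (auto simp: GL_def intro: bij_comp Vector_Spaces.linear_compose)
qed (auto simp: GL_def comp_assoc)

lemma inv_GL:
  fixes sc :: "complex \<Rightarrow> 'v::ab_group_add \<Rightarrow> 'v"
  assumes "vector_space sc" "g \<in> carrier (GL sc)"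
  shows "inv\<^bsub>GL sc\<^esub> g = inv_into UNIV g"
proof -
  interpret group "GL sc" by (rule group_GL) fact
  have *: "inv\<^bsub>GL sc\<^esub> g \<circ> g = id" using l_inv[OF assms(2)] by (simp add: GL_def)
  have "inj g" "surj g" using assms(2) by (auto simp: GL_def bij_def)
  show ?thesis
  proof
    fix x
    obtain y where "x = g y" using \<open>surj g\<close> by blast
    then show "(inv\<^bsub>GL sc\<^esub> g) x = inv_into UNIV g x"
      using * \<open>inj g\<close> by (metis comp_apply id_apply inv_f_f)
  qed
qed

section \<open>Reflections and hyperplanes under the action of a linear group\<close>

locale linear_group =
  fixes sc :: "complex \<Rightarrow> 'v::ab_group_add \<Rightarrow> 'v"
    and Basis :: "'v set" and W :: "('v \<Rightarrow> 'v) set"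
  assumes finite_dim: "finite_dimensional_vector_space sc Basis"
    and subgroup_W: "subgroup W (GL sc)"
begin

sublocale V: finite_dimensional_vector_space sc Basis by (rule finite_dim)

lemma W_linear: "w \<in> W \<Longrightarrow> Vector_Spaces.linear sc sc w"
  and W_bij: "w \<in> W \<Longrightarrow> bij w"
  using subgroup.subset[OF subgroup_W] by (auto simp: GL_def)

lemma W_comp [simp]: "w \<in> W \<Longrightarrow> w' \<in> W \<Longrightarrow> w \<circ> w' \<in> W"
  using subgroup.m_closed[OF subgroup_W] by (simp add: GL_def)

lemma W_id [simp]: "id \<in> W"
  using subgroup.one_closed[OF subgroup_W] by (simp add: GL_def)

lemma W_inv [simp]: "w \<in> W \<Longrightarrow> inv_into UNIV w \<in> W"
  using subgroup.m_inv_closed[OF subgroup_W] inv_GL[OF V.vector_space_axioms]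
    subgroup.mem_carrier[OF subgroup_W] by metis

lemma W_inv_left [simp]: "w \<in> W \<Longrightarrow> inv_into UNIV w (w v) = v"
  and W_inv_right [simp]: "w \<in> W \<Longrightarrow> w (inv_into UNIV w v) = v"
  using W_bij by (auto simp: bij_is_inj bij_is_surj surj_f_inv_f)

lemma W_inv_comp: "w \<in> W \<Longrightarrow> inv_into UNIV w \<circ> w = id" "w \<in> W \<Longrightarrow> w \<circ> inv_into UNIV w = id"
  by auto

lemma W_inv_inv [simp]: "w \<in> W \<Longrightarrow> inv_into UNIV (inv_into UNIV w) = w"
  by (simp add: W_bij inv_inv_eq)

lemma W_image_inv [simp]:
  "w \<in> W \<Longrightarrow> inv_into UNIV w ` w ` H = H"
  "w \<in> W \<Longrightarrow> w ` inv_into UNIV w ` H = H"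
  by (auto simp: image_image)

lemma W_image_eq_iff: "w \<in> W \<Longrightarrow> w ` A = w ` B \<longleftrightarrow> A = B"
  by (metis W_image_inv(1))

lemma conj_map_apply: "conj_map w g v = w (g (inv_into UNIV w v))"
  by (simp add: conj_map_def)

lemma conj_map_in [simp]: "w \<in> W \<Longrightarrow> g \<in> W \<Longrightarrow> conj_map w g \<in> W"
  by (simp add: conj_map_def)

lemma conj_map_comp: "w \<in> W \<Longrightarrow> conj_map w g \<circ> w = w \<circ> g"
  by (auto simp: conj_map_apply)

lemma conj_map_inv [simp]:
  "w \<in> W \<Longrightarrow> conj_map (inv_into UNIV w) (conj_map w g) = g"
  "w \<in> W \<Longrightarrow> conj_map w (conj_map (inv_into UNIV w) g) = g"
  by (auto simp: conj_map_apply)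

lemma Fix_conj_map: "w \<in> W \<Longrightarrow> Fix (conj_map w g) = w ` Fix g"
proof safe
  fix v assume w: "w \<in> W" and "v \<in> Fix (conj_map w g)"
  then have "inv_into UNIV w v \<in> Fix g"
    by (metis (mono_tags, lifting) Fix_def W_inv_left conj_map_apply mem_Collect_eq)
  then show "v \<in> w ` Fix g"
    using w by (intro image_eqI[of _ _ "inv_into UNIV w v"]) auto
qed (auto simp: Fix_def conj_map_apply)

lemma conj_map_fixes_subgroup:
  assumes "subgroup L (GL sc)" "s \<in> L" "L \<subseteq> W"
  shows "conj_map s ` L = L"
proof -
  \<comment> \<open>The same locale at \<open>L\<close> supplies closure of \<open>L\<close> under
    composition and inverses, hence under conjugation by its own elements.\<close>
  interpret L: linear_group sc Basis L by (intro linear_group.intro finite_dim assms(1))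
  show ?thesis
  proof safe
    fix g assume "g \<in> L"
    then show "conj_map s g \<in> L" using assms by simp
    have "g = conj_map s (conj_map (inv_into UNIV s) g)" "conj_map (inv_into UNIV s) g \<in> L"
      using assms \<open>g \<in> L\<close> by auto
    then show "g \<in> conj_map s ` L" by blast
  qed
qed

lemma hyp_stabilizer_conj:
  assumes "w \<in> W"
  shows "conj_map w ` hyp_stabilizer W H = hyp_stabilizer W (w ` H)"
proof -
  \<comment> \<open>This inclusion is proved for all group elements and subsets, so that the reverse
    one follows by applying it to the inverse of \<open>w\<close>.\<close>
  have *: "conj_map w' g \<in> hyp_stabilizer W (w' ` H')"
    if "g \<in> hyp_stabilizer W H'" "w' \<in> W" for w' g H'
    using that by (auto simp: hyp_stabilizer_def conj_map_apply)
  show ?thesis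
  proof safe
    fix g assume g: "g \<in> hyp_stabilizer W (w ` H)"
    have "conj_map (inv_into UNIV w) g \<in> hyp_stabilizer W H"
      using *[OF g, of "inv_into UNIV w"] assms by simp
    then show "g \<in> conj_map w ` hyp_stabilizer W H"
      using assms by (metis conj_map_inv(2) image_eqI)
  qed (use * assms in blast)
qed

text \<open>The fixed space of the conjugate is the image of the fixed space under an injective
  linear map, so the dimension does not change.\<close>

lemma conj_map_reflection:
  assumes "w \<in> W" "s \<in> reflections sc W"
  shows "conj_map w s \<in> reflections sc W"
proof -
  interpret P: finite_dimensional_vector_space_pair_1 sc Basis sc by unfold_locales
  have "V.dim (w ` Fix s) = V.dim (Fix s)"
    by (rule P.dim_image_eq) (use W_linear W_bij assms in \<open>auto simp: bij_def intro: inj_on_subset\<close>)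
  then show ?thesis
    using assms by (auto simp: reflections_def Fix_conj_map)
qed

lemma image_hyperplane [simp]:
  assumes "w \<in> W" "H \<in> hyperplanes sc W"
  shows "w ` H \<in> hyperplanes sc W"
  using assms conj_map_reflection Fix_conj_map unfolding hyperplanes_def by blast

lemma bij_betw_conj_reflections:
  assumes "w \<in> W"
  shows "bij_betw (conj_map w) {s \<in> reflections sc W. Fix s = H}
    {s \<in> reflections sc W. Fix s = w ` H}"
  by (rule bij_betwI[where g = "conj_map (inv_into UNIV w)"])
     (use assms in \<open>auto simp: conj_map_reflection Fix_conj_map\<close>)

lemma Fix_reflection_in: "s \<in> reflections sc W \<Longrightarrow> Fix s \<in> hyperplanes sc W"
  by (auto simp: hyperplanes_def)

lemma reflection_in_W: "s \<in> reflections sc W \<Longrightarrow> s \<in> W"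
  by (auto simp: reflections_def)

lemma reflection_in_stabilizer: "s \<in> reflections sc W \<Longrightarrow> s \<in> hyp_stabilizer W (Fix s)"
  by (auto simp: reflections_def hyp_stabilizer_def Fix_def)

lemma hyperplane_proper: "H \<in> hyperplanes sc W \<Longrightarrow> H \<noteq> UNIV"
  by (auto simp: hyperplanes_def reflections_def)

lemma image_Fix: "s ` Fix s = Fix s"
  by (force simp: Fix_def)

end

section \<open>Incidence of hyperplanes through their linear forms\<close>

locale hyperplane_forms = linear_group sc Basis W
  for sc :: "complex \<Rightarrow> 'v::ab_group_add \<Rightarrow> 'v" and Basis W +
  fixes \<alpha> :: "'v set \<Rightarrow> 'v \<Rightarrow> complex"
  assumes form_linear: "H \<in> hyperplanes sc W \<Longrightarrow> Vector_Spaces.linear sc (*) (\<alpha> H)"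
    and form_kernel: "H \<in> hyperplanes sc W \<Longrightarrow> {v. \<alpha> H v = 0} = H"
begin

lemma form_eq_0_iff: "H \<in> hyperplanes sc W \<Longrightarrow> \<alpha> H v = 0 \<longleftrightarrow> v \<in> H"
  using form_kernel by blast

lemma form_combination:
  assumes "H \<in> hyperplanes sc W" "K \<in> hyperplanes sc W" "L \<in> hyperplanes sc W" "H \<inter> K \<subseteq> L"
  obtains a b where "\<And>v. \<alpha> L v = a * \<alpha> H v + b * \<alpha> K v"
  using V.linear_form_dependent2[of "\<alpha> H" "\<alpha> K" "\<alpha> L"] assms form_linear form_eq_0_iff by blast

text \<open>Steinitz exchange for the linear forms, read off on their kernels.\<close>
lemma hyperplane_exchange:
  assumes H: "H \<in> hyperplanes sc W" and K: "K \<in> hyperplanes sc W" and L: "L \<in> hyperplanes sc W"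
    and "H \<inter> K \<subseteq> L" "H \<noteq> L"
  shows "H \<inter> L \<subseteq> K"
proof -
  obtain a b where ab: "\<And>v. \<alpha> L v = a * \<alpha> H v + b * \<alpha> K v"
    using form_combination assms by metis
  have "b \<noteq> 0"
  proof
    assume b: "b = 0"
    obtain v where "\<alpha> L v \<noteq> 0" using hyperplane_proper L form_eq_0_iff by blast
    then have "a \<noteq> 0" using ab b by auto
    then have "v \<in> H \<longleftrightarrow> v \<in> L" for v
      using ab[of v] b form_eq_0_iff[OF H, of v] form_eq_0_iff[OF L, of v] by auto
    then show False using assms by blast
  qed
  then have "v \<in> K" if "v \<in> H" "v \<in> L" for v
    using that ab[of v] form_eq_0_iff[OF H, of v] form_eq_0_iff[OF K, of v]
      form_eq_0_iff[OF L, of v] by auto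
  then show ?thesis by blast
qed

text \<open>Exchange is applied twice, first putting \<open>H\<close> in place of \<open>H2\<close>
  and then \<open>K\<close> in place of \<open>H1\<close>. The result lets pairs of distinct
  hyperplanes be sorted by their intersection.\<close>

lemma flat_eq:
  assumes "H1 \<in> hyperplanes sc W" "H2 \<in> hyperplanes sc W"
    "H \<in> hyperplanes sc W" "K \<in> hyperplanes sc W" "H1 \<inter> H2 \<subseteq> H" "H1 \<inter> H2 \<subseteq> K" "H \<noteq> K"
  shows "H \<inter> K = H1 \<inter> H2"
proof (cases "H = H1")
  case True
  then show ?thesis using hyperplane_exchange[of H1 H2 K] assms by blast
next
  case False
  then have "H1 \<inter> H \<subseteq> H2" using hyperplane_exchange[of H1 H2 H] assms by blast
  then have "H \<inter> K \<subseteq> H1" using hyperplane_exchange[of H H1 K] assms by blast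
  with \<open>H1 \<inter> H \<subseteq> H2\<close> show ?thesis using assms by blast
qed

text \<open>Points of \<open>H\<close> fixed by \<open>s\<close> lie in the image of
  \<open>H\<close> as well, so \<open>H\<close>, its image and \<open>Fix s\<close> contain a common
  flat, and exchange turns the inclusion around.\<close>

lemma moving_reflection_hyperplane:
  assumes "s \<in> reflections sc W" "H \<in> hyperplanes sc W" "s ` H \<noteq> H"
  shows "H \<inter> s ` H \<subseteq> Fix s"
proof -
  have "H \<inter> Fix s \<subseteq> s ` H" by (force simp: Fix_def)
  then show ?thesis
    using hyperplane_exchange[of H "Fix s" "s ` H"] assms
    by (simp add: Fix_reflection_in reflection_in_W)
qed

text \<open>The hyperplane of such a reflection would contain the intersection, so by transversality
  it would be \<open>H1\<close> or \<open>H2\<close>; but a reflection maps its own hyperplane to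
  itself.\<close>

lemma transverse_no_reflection:
  assumes "H1 \<in> hyperplanes sc W" "H2 \<in> hyperplanes sc W" "transverse sc W H1 H2"
    and "s \<in> reflections sc W"
  shows "s ` H2 \<noteq> H1"
proof
  assume s: "s ` H2 = H1"
  have ne: "H1 \<noteq> H2" using assms(3) by (simp add: transverse_def)
  then have "H1 \<inter> H2 \<subseteq> Fix s"
    using moving_reflection_hyperplane[of s H2] assms s by auto
  then have "Fix s \<in> {H1, H2}"
    using assms(3,4) Fix_reflection_in unfolding transverse_def by blast
  then show False
    using s ne image_Fix[of s] W_image_eq_iff[of s H2 H1] reflection_in_W[OF assms(4)] by auto
qed

end

section \<open>Logarithmic forms\<close>

text \<open>The value is symmetric in \<open>u\<close> and \<open>v\<close>, and this symmetry is
  the closedness of the logarithmic form.\<close>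

lemma deriv_log_form:
  fixes sc :: "complex \<Rightarrow> 'v::ab_group_add \<Rightarrow> 'v"
  assumes "Vector_Spaces.linear sc (*) \<beta>" "\<beta> x \<noteq> 0"
  shows "((\<lambda>t. log_form \<beta> (x + sc t u) v) has_field_derivative
    - (1 / (complex_of_real pi * \<i>) * (\<beta> u * \<beta> v / (\<beta> x)\<^sup>2))) (at 0)"
proof -
  interpret Vector_Spaces.linear sc "(*)" \<beta> by fact
  have "(\<lambda>t. log_form \<beta> (x + sc t u) v)
      = (\<lambda>t. 1 / (complex_of_real pi * \<i>) * (\<beta> v / (\<beta> x + t * \<beta> u)))"
    by (simp add: log_form_def add scale)
  moreover have "((\<lambda>t. \<beta> v / (\<beta> x + t * \<beta> u)) has_field_derivative
      - (\<beta> u * \<beta> v / (\<beta> x)\<^sup>2)) (at 0)"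
    using assms(2) by (auto intro!: derivative_eq_intros simp: power2_eq_square)
  ultimately show ?thesis
    using DERIV_cmult by (metis mult_minus_right)
qed

lemma log_form_in_forms1:
  fixes sc :: "complex \<Rightarrow> 'v::ab_group_add \<Rightarrow> 'v"
  assumes lin: "Vector_Spaces.linear sc (*) \<beta>" and nz: "\<And>x. x \<in> X \<Longrightarrow> \<beta> x \<noteq> 0"
  shows "log_form \<beta> \<in> forms1 sc X"
proof -
  interpret Vector_Spaces.linear sc "(*)" \<beta> by fact
  have "Vector_Spaces.linear sc (*) (log_form \<beta> x)" for x
    by unfold_locales (simp_all add: log_form_def add scale add_divide_distrib algebra_simps)
  then show ?thesis
    using deriv_log_form[OF lin nz] unfolding forms1_def field_differentiable_def by blast
qed

lemma ext_d_log_form: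
  fixes sc :: "complex \<Rightarrow> 'v::ab_group_add \<Rightarrow> 'v"
  assumes "Vector_Spaces.linear sc (*) \<beta>" "\<beta> x \<noteq> 0"
  shows "ext_d sc (log_form \<beta>) x u v = 0"
  using deriv_log_form[OF assms, THEN DERIV_imp_deriv]
  by (simp add: ext_d_def mult.commute)

section \<open>Commutation relations in the Brauer algebra\<close>

locale brauer_connection = hyperplane_forms sc Basis W \<alpha>
  for sc :: "complex \<Rightarrow> 'v::ab_group_add \<Rightarrow> 'v" and Basis W \<alpha> +
  fixes \<L> :: "('v \<Rightarrow> 'v) set set" and \<mu> :: "('v \<Rightarrow> 'v) \<Rightarrow> complex" and lam :: "'v set \<Rightarrow> complex"
  assumes finite_W: "finite W"
    and admissible: "admissible_lattice sc W \<L>"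
    and \<mu>_conj: "s \<in> reflections sc W \<Longrightarrow> w \<in> W \<Longrightarrow> \<mu> (conj_map w s) = \<mu> s"
    and lam_image: "H \<in> hyperplanes sc W \<Longrightarrow> w \<in> W \<Longrightarrow> lam (w ` H) = lam H"
begin

abbreviation "\<H> \<equiv> hyperplanes sc W"
abbreviation "\<R> \<equiv> reflections sc W"
abbreviation "stab \<equiv> hyp_stabilizer W"

sublocale L: Lattice.lattice "inclusion_order \<L>"
  using admissible by (simp add: admissible_lattice_def)

lemma finite_reflections [simp]: "finite \<R>"
  using finite_W by (simp add: reflections_def)

lemma finite_hyperplanes [simp]: "finite \<H>"
  by (simp add: hyperplanes_def)

lemma stab_in [simp]: "H \<in> \<H> \<Longrightarrow> stab H \<in> \<L>"
  using admissible by (simp add: admissible_lattice_def)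

lemma conj_in_lattice [simp]: "w \<in> W \<Longrightarrow> L \<in> \<L> \<Longrightarrow> conj_map w ` L \<in> \<L>"
  using admissible by (simp add: admissible_lattice_def)

lemma lattice_subgroup: "L \<in> \<L> \<Longrightarrow> subgroup L (GL sc)" "L \<in> \<L> \<Longrightarrow> L \<subseteq> W"
  using admissible
  by (auto simp: admissible_lattice_def full_reflection_subgroup_def reflection_subgroup_def)

lemma trivial_in [simp]: "{id} \<in> \<L>"
  using admissible by (simp add: admissible_lattice_def)

abbreviation join_L (infixl "\<squnion>" 65) where "K \<squnion> L \<equiv> K \<squnion>\<^bsub>inclusion_order \<L>\<^esub> L"

lemma join_in [simp]: "K \<in> \<L> \<Longrightarrow> L \<in> \<L> \<Longrightarrow> K \<squnion> L \<in> \<L>"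
  using L.join_closed[of K L] by (simp add: inclusion_order_def)

lemma join_upper: "K \<in> \<L> \<Longrightarrow> L \<in> \<L> \<Longrightarrow> K \<subseteq> K \<squnion> L"
  using L.join_left[of K L] by (simp add: inclusion_order_def)

lemma join_comm: "K \<squnion> L = L \<squnion> K"
  by (simp add: join_def insert_commute)

section \<open>Generators and defining relations as congruences\<close>

abbreviation "S \<equiv> br_gens sc W \<L>"
abbreviation "Rel \<equiv> br_relators sc W \<L> \<mu>"

lemma gens_carrier [simp]:
  "w \<in> W \<Longrightarrow> bw w \<in> free_carrier S"
  "H \<in> \<H> \<Longrightarrow> be H \<in> free_carrier S"
  "L \<in> \<L> \<Longrightarrow> bf L \<in> free_carrier S"
  by (auto simp: br_gens_def)

lemma reflection_carrier [simp]:
  "s \<in> \<R> \<Longrightarrow> s \<in> W" "s \<in> \<R> \<Longrightarrow> Fix s \<in> \<H>"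
  by (simp_all add: reflection_in_W Fix_reflection_in)

lemma br_refl_sum_carrier [simp]: "br_refl_sum sc W \<mu> H K \<in> free_carrier S"
  by (auto simp: br_refl_sum_def intro!: free_carrier_sum free_carrier_mult)

lemma br_relations_carrier:
  "(p, q) \<in> br_relations sc W \<L> \<mu> \<Longrightarrow> p \<in> free_carrier S \<and> q \<in> free_carrier S"
  by (induction rule: br_relations.induct) auto

sublocale presentation S Rel
  by unfold_locales (auto simp: br_relators_def dest: br_relations_carrier)

notation cong (infix "\<doteq>" 50)

lemma cong_relation: "(p, q) \<in> br_relations sc W \<L> \<mu> \<Longrightarrow> p \<doteq> q"
  using br_relations_carrier[of p q] by (intro cong_rel) (auto simp: br_relators_def)

text \<open>Numbered as the introduction rules: \<open>rel(1)\<close> and \<open>rel(2)\<close> are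
  the multiplication of \<open>W\<close>, \<open>rel(3)\<close> and \<open>rel(4)\<close> the
  conjugation of \<open>e\<close> and \<open>f\<close>, and \<open>rel(11)\<close> is the product of
  two \<open>f\<close>.\<close>

lemmas rel = br_relations.intros[THEN cong_relation]

section \<open>The coefficients of the connection form\<close>

definition refl_sum where "refl_sum H = (\<Sum>s \<in> {s \<in> \<R>. Fix s = H}. const (\<mu> s) * bw s)"
text \<open>The coefficient \<open>t_H\<close> of the overview, as a representative in the free
  algebra.\<close>

definition residue where "residue H = ((const (lam H) + refl_sum H) - be H) * bf (stab H)"
text \<open>The common summand of \<open>br_refl_sum\<close> and of the expanded residues, which
  makes the two comparable.\<close>

definition refl_term where "refl_term s = const (\<mu> s) * bw s * bf (stab (Fix s))"

lemma carriers [simp]: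
  "refl_sum H \<in> free_carrier S" "s \<in> \<R> \<Longrightarrow> refl_term s \<in> free_carrier S"
  "H \<in> \<H> \<Longrightarrow> residue H \<in> free_carrier S"
  by (auto simp: refl_sum_def refl_term_def residue_def
      intro!: free_carrier_sum free_carrier_mult free_carrier_add free_carrier_diff)

lemma bw_conj:
  assumes "w \<in> W" "s \<in> W"
  shows "bw w * bw s \<doteq> bw (conj_map w s) * bw w"
proof -
  have "bw w * bw s \<doteq> bw (w \<circ> s)" using assms by (intro rel)
  also have "w \<circ> s = conj_map w s \<circ> w" using assms by (simp add: conj_map_comp)
  also have "bw (conj_map w s \<circ> w) \<doteq> bw (conj_map w s) * bw w"
    using assms by (intro rel[THEN cong_sym]) auto
  finally show ?thesis .
qed

lemma bw_stab: "w \<in> W \<Longrightarrow> H \<in> \<H> \<Longrightarrow> bw w * bf (stab H) \<doteq> bf (stab (w ` H)) * bw w"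
  using rel(4)[of w "stab H"] by (simp add: hyp_stabilizer_conj)

text \<open>Conjugation by \<open>w\<close> permutes the summands, and their scalars agree because
  \<open>\<mu>\<close> is constant on conjugacy classes.\<close>

lemma bw_refl_sum:
  assumes "w \<in> W"
  shows "bw w * refl_sum H \<doteq> refl_sum (w ` H) * bw w"
proof -
  have "bw w * refl_sum H = (\<Sum>s \<in> {s \<in> \<R>. Fix s = H}. const (\<mu> s) * (bw w * bw s))"
    by (simp add: refl_sum_def sum_distrib_left const_left_commute)
  also have "\<dots> \<doteq> (\<Sum>s \<in> {s \<in> \<R>. Fix s = H}. const (\<mu> s) * (bw (conj_map w s) * bw w))"
    using assms by (intro cong_sum cong_mult cong_refl bw_conj) auto
  also have "\<dots> = (\<Sum>s \<in> {s \<in> \<R>. Fix s = H}. const (\<mu> (conj_map w s)) * (bw (conj_map w s) * bw w))"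
    using assms by (intro sum.cong) (auto simp: \<mu>_conj)
  also have "\<dots> = refl_sum (w ` H) * bw w"
    unfolding refl_sum_def sum_distrib_right mult.assoc
    by (rule sum.reindex_bij_betw[OF bij_betw_conj_reflections[OF assms]])
  finally show ?thesis .
qed

text \<open>Equivariance at the level of coefficients. It serves both for the equivariance of the
  form and, with \<open>w\<close> a reflection, for the commutation of pencil sums with
  \<open>w\<close>.\<close>

lemma bw_residue:
  assumes "w \<in> W" "H \<in> \<H>"
  shows "bw w * residue H \<doteq> residue (w ` H) * bw w"
proof -
  define X where "X H = (const (lam H) + refl_sum H) - be H" for H
  have X [simp]: "H \<in> \<H> \<Longrightarrow> X H \<in> free_carrier S" for H by (simp add: X_def)
  have "bw w * X H = const (lam H) * bw w + bw w * refl_sum H - bw w * be H"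
    by (simp add: X_def algebra_simps const_commute)
  also have "\<dots> \<doteq> const (lam H) * bw w + refl_sum (w ` H) * bw w - be (w ` H) * bw w"
    using assms by (intro cong_add cong_diff bw_refl_sum rel) auto
  also have "\<dots> = X (w ` H) * bw w"
    unfolding X_def distrib_right left_diff_distrib lam_image[OF assms(2,1)] by (rule refl)
  finally have "bw w * X H * bf (stab H) \<doteq> X (w ` H) * bw w * bf (stab H)"
    using assms by (intro cong_mult_left) auto
  also have "\<dots> \<doteq> X (w ` H) * (bf (stab (w ` H)) * bw w)"
    unfolding mult.assoc using assms by (intro cong_mult_right bw_stab) auto
  finally show ?thesis
    by (simp add: residue_def X_def mult.assoc)
qed

section \<open>Commutation with the generators \<open>f_L\<close> and \<open>e_H\<close>\<close>

lemma bf_comm: "K \<in> \<L> \<Longrightarrow> L \<in> \<L> \<Longrightarrow> commutes (bf K) (bf L)"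
  using cong_trans[OF rel(11)[of K L] rel(11)[of L K, THEN cong_sym, unfolded join_comm[of L K]]]
  by (simp add: commutes_def)

lemma be_bf_comm: "H \<in> \<H> \<Longrightarrow> L \<in> \<L> \<Longrightarrow> commutes (be H) (bf L)"
  by (simp add: commutes_def rel)

text \<open>Conjugation by an element of \<open>L\<close> fixes the join of \<open>K\<close> and \<open>L\<close>, although it may move \<open>K\<close>.\<close>
lemma bf_comm_bw_bf:
  assumes K: "K \<in> \<L>" and L: "L \<in> \<L>" and s: "s \<in> L"
  shows "commutes (bf K) (bw s * bf L)"
proof -
  have sW: "s \<in> W" using lattice_subgroup(2)[OF L] s by blast
  have "s \<in> K \<squnion> L" using join_upper[OF L K] s by (auto simp: join_comm)
  then have conj_J: "conj_map s ` (K \<squnion> L) = K \<squnion> L"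
    by (intro conj_map_fixes_subgroup lattice_subgroup join_in K L)
  have conj_L: "conj_map s ` L = L"
    by (intro conj_map_fixes_subgroup lattice_subgroup L s)
  have "bf K * (bw s * bf L) \<doteq> bf K * (bf L * bw s)"
    using rel(4)[OF sW L] conj_L K by (intro cong_mult_right) auto
  also have "\<dots> \<doteq> bf (K \<squnion> L) * bw s"
    unfolding mult.assoc[symmetric] using K L sW by (intro cong_mult_left rel) auto
  also have "\<dots> \<doteq> bw s * bf (K \<squnion> L)"
    using rel(4)[OF sW join_in[OF K L]] conj_J by (auto intro: cong_sym)
  also have "\<dots> \<doteq> bw s * (bf L * bf K)"
    using K L sW rel(11)[OF L K] by (intro cong_mult_right) (auto intro: cong_sym simp: join_comm)
  finally show ?thesis
    using K L sW by (simp add: commutes_def mult.assoc)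
qed

text \<open>The absorption of \<open>f_H\<close> by \<open>e_H\<close> removes the factor from the
  last term, while the reflections keep it, as they do in the relations for products of two
  \<open>e\<close>.\<close>

lemma residue_expand:
  assumes "H \<in> \<H>"
  shows "residue H \<doteq> const (lam H) * bf (stab H) + (\<Sum>s \<in> {s \<in> \<R>. Fix s = H}. refl_term s) - be H"
proof -
  have "residue H = const (lam H) * bf (stab H) + (\<Sum>s \<in> {s \<in> \<R>. Fix s = H}. refl_term s)
      - be H * bf (stab H)"
    by (auto simp: residue_def refl_sum_def refl_term_def algebra_simps sum_distrib_right
        intro: sum.cong)
  also have "\<dots> \<doteq> const (lam H) * bf (stab H) + (\<Sum>s \<in> {s \<in> \<R>. Fix s = H}. refl_term s) - be H"
    using assms by (intro cong_diff cong_add rel) (auto intro!: free_carrier_sum)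
  finally show ?thesis .
qed

text \<open>Each reflection with hyperplane \<open>H\<close> lies in \<open>stab H\<close>, so
  \<open>bf_comm_bw_bf\<close> applies to its term in the expanded residue.\<close>

lemma bf_comm_residue:
  assumes "K \<in> \<L>" "H \<in> \<H>"
  shows "commutes (bf K) (residue H)"
proof (rule commutes_cong[OF _ residue_expand[OF assms(2), THEN cong_sym]])
  have "commutes (bf K) (refl_term s)" if "s \<in> \<R>" for s
    unfolding refl_term_def mult.assoc
    using that assms reflection_in_stabilizer
    by (intro commutes_mult commutes_const bf_comm_bw_bf) auto
  moreover have "commutes (bf K) (be H)"
    using assms by (intro be_bf_comm[THEN commutes_sym])
  ultimately show "commutes (bf K)
      (const (lam H) * bf (stab H) + (\<Sum>s \<in> {s \<in> \<R>. Fix s = H}. refl_term s) - be H)"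
    using assms
    by (intro commutes_diff commutes_add commutes_mult commutes_sum commutes_const bf_comm) auto
qed

text \<open>Each product is rewritten by the version of the relation that keeps \<open>be H\<close>
  and eliminates \<open>be K\<close>. For a transverse pair the commutator is 0 and both reflection
  sums are empty, so one formula covers both cases.\<close>

lemma be_commutator:
  assumes "H \<in> \<H>" "K \<in> \<H>" "H \<noteq> K"
  shows "be H * be K - be K * be H \<doteq>
    be H * br_refl_sum sc W \<mu> H K - br_refl_sum sc W \<mu> K H * be H"
proof (cases "transverse sc W H K")
  case True
  then have True': "transverse sc W K H"
    by (simp add: transverse_def Int_commute insert_commute eq_commute)
  have "be H * be K - be K * be H \<doteq> be K * be H - be K * be H"
    using assms True by (intro cong_diff rel) auto
  moreover have "br_refl_sum sc W \<mu> H K = 0" "br_refl_sum sc W \<mu> K H = 0"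
    using transverse_no_reflection True True' assms unfolding br_refl_sum_def
    by (auto intro!: sum.neutral)
  ultimately show ?thesis by simp
next
  case False
  then have "\<not> transverse sc W K H"
    by (simp add: transverse_def Int_commute insert_commute eq_commute)
  with False show ?thesis using assms by (intro cong_diff rel) auto
qed

lemma refl_term_comm_be:
  assumes "s \<in> \<R>" "H \<in> \<H>" "s ` H = H"
  shows "commutes (be H) (refl_term s)"
proof -
  have "commutes (be H) (bw s)"
    using rel(3)[of s H] assms by (auto simp: commutes_def intro: cong_sym)
  then show ?thesis
    unfolding refl_term_def using assms
    by (intro commutes_mult commutes_const be_bf_comm) auto
qed

section \<open>Sums over the hyperplanes through a flat\<close>

definition pencil where "pencil Z = {H \<in> \<H>. Z \<subseteq> H}"

lemma finite_pencil [simp]: "finite (pencil Z)"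
  by (simp add: pencil_def)

lemma pencil_hyperplane: "H \<in> pencil Z \<Longrightarrow> H \<in> \<H>"
  by (simp add: pencil_def)

text \<open>Such a reflection and its inverse fix \<open>Z\<close> pointwise.\<close>

lemma image_pencil:
  assumes "s \<in> \<R>" "Fix s \<in> pencil Z" "H \<in> pencil Z"
  shows "s ` H \<in> pencil Z" "inv_into UNIV s ` H \<in> pencil Z"
proof -
  have "Z \<subseteq> Fix s" "Z \<subseteq> H" using assms by (auto simp: pencil_def)
  have "s v = v" "inv_into UNIV s v = v" if "v \<in> Z" for v
  proof -
    show "s v = v" using that \<open>Z \<subseteq> Fix s\<close> by (auto simp: Fix_def)
    then show "inv_into UNIV s v = v" using W_inv_left[of s v] assms(1) by simp
  qed
  then have "Z \<subseteq> s ` H" "Z \<subseteq> inv_into UNIV s ` H" using \<open>Z \<subseteq> H\<close> by force+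
  then show "s ` H \<in> pencil Z" "inv_into UNIV s ` H \<in> pencil Z"
    using assms by (auto simp: pencil_def)
qed

lemma moving_reflection_pencil:
  assumes "s \<in> \<R>" "H \<in> pencil Z" "s ` H \<in> pencil Z" "s ` H \<noteq> H"
  shows "Fix s \<in> pencil Z"
  using moving_reflection_hyperplane[of s H] assms by (auto simp: pencil_def)

definition pencil_residue where "pencil_residue Z = (\<Sum>H \<in> pencil Z. residue H)"

lemma pencil_residue_carrier [simp]: "pencil_residue Z \<in> free_carrier S"
  unfolding pencil_residue_def by (intro free_carrier_sum) (auto simp: pencil_def)

lemma bf_comm_pencil: "K \<in> \<L> \<Longrightarrow> commutes (bf K) (pencil_residue Z)"
  unfolding pencil_residue_def
  by (intro commutes_sum bf_comm_residue) (auto simp: pencil_def)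

text \<open>The reflection permutes the pencil, so conjugation by it permutes the summands of
  \<open>pencil_residue Z\<close>.\<close>

lemma bw_comm_pencil:
  assumes "s \<in> \<R>" "Fix s \<in> pencil Z"
  shows "commutes (bw s) (pencil_residue Z)"
proof -
  have s: "s \<in> W" using assms by simp
  have bij: "bij_betw ((`) s) (pencil Z) (pencil Z)"
    by (rule bij_betwI[where g = "(`) (inv_into UNIV s)"]) (use s image_pencil assms in auto)
  have "bw s * pencil_residue Z = (\<Sum>H \<in> pencil Z. bw s * residue H)"
    by (simp add: pencil_residue_def sum_distrib_left)
  also have "\<dots> \<doteq> (\<Sum>H \<in> pencil Z. residue (s ` H) * bw s)"
    using s by (intro cong_sum bw_residue) (auto simp: pencil_def)
  also have "\<dots> = pencil_residue Z * bw s"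
    unfolding pencil_residue_def sum_distrib_right by (rule sum.reindex_bij_betw[OF bij])
  finally show ?thesis using s by (simp add: commutes_def)
qed

definition pencil_reflections where "pencil_reflections Z = {s \<in> \<R>. Fix s \<in> pencil Z}"

lemma finite_pencil_reflections [simp]: "finite (pencil_reflections Z)"
  by (simp add: pencil_reflections_def)

lemma refl_term_partition:
  "(\<Sum>H \<in> pencil Z. \<Sum>s \<in> {s \<in> \<R>. Fix s = H}. refl_term s) = sum refl_term (pencil_reflections Z)"
proof -
  have "(\<Sum>H \<in> pencil Z. \<Sum>s \<in> {s \<in> \<R>. Fix s = H}. refl_term s) =
      (\<Sum>H \<in> pencil Z. sum refl_term {s \<in> pencil_reflections Z. Fix s = H})"
    by (intro sum.cong) (auto simp: pencil_reflections_def)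
  also have "\<dots> = sum refl_term (pencil_reflections Z)"
    by (rule sum.group) (auto simp: pencil_reflections_def)
  finally show ?thesis .
qed

text \<open>A reflection carrying one member of the pencil to a different one has its own hyperplane
  in the pencil, so restricting to \<open>pencil_reflections\<close> loses nothing. The second
  equivalence involves the inverse because \<open>br_refl_sum\<close> at \<open>H\<close>,
  \<open>K\<close> collects the reflections taking \<open>K\<close> to \<open>H\<close>.\<close>

lemma mover_iff:
  assumes H: "H \<in> pencil Z" and K: "K \<in> pencil Z" "K \<noteq> H"
  shows "s \<in> pencil_reflections Z \<and> s ` H \<noteq> H \<and> s ` H = K \<longleftrightarrow> s \<in> \<R> \<and> s ` H = K"
    and "s \<in> pencil_reflections Z \<and> s ` H \<noteq> H \<and> inv_into UNIV s ` H = K \<longleftrightarrow> s \<in> \<R> \<and> s ` K = H"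
proof -
  show "s \<in> pencil_reflections Z \<and> s ` H \<noteq> H \<and> s ` H = K \<longleftrightarrow> s \<in> \<R> \<and> s ` H = K"
    using moving_reflection_pencil[of s H Z] assms by (auto simp: pencil_reflections_def)
  have *: "inv_into UNIV s ` H = K \<longleftrightarrow> s ` K = H" if "s \<in> \<R>"
    using that by (metis W_image_inv reflection_carrier(1))
  have "s \<in> pencil_reflections Z \<and> s ` H \<noteq> H" if "s \<in> \<R>" "s ` K = H"
    using moving_reflection_pencil[of s K Z] assms that W_image_eq_iff[of s H K]
    by (auto simp: pencil_reflections_def)
  then show "s \<in> pencil_reflections Z \<and> s ` H \<noteq> H \<and> inv_into UNIV s ` H = K \<longleftrightarrow> s \<in> \<R> \<and> s ` K = H"
    using * by (auto simp: pencil_reflections_def)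
qed

text \<open>A reflection in \<open>M\<close> takes \<open>H\<close> to exactly one other member of
  the pencil, and takes exactly one other member to \<open>H\<close>. Each double sum therefore runs
  through \<open>M\<close> once, and the equality of the totals yields the cancellation in
  \<open>be_comm_pencil\<close>.\<close>

lemma sum_movers:
  assumes H: "H \<in> pencil Z"
  defines "M \<equiv> {s \<in> pencil_reflections Z. s ` H \<noteq> H}"
  shows "(\<Sum>K \<in> pencil Z - {H}. br_refl_sum sc W \<mu> H K) = sum refl_term M"
    and "(\<Sum>K \<in> pencil Z - {H}. br_refl_sum sc W \<mu> K H) = sum refl_term M"
proof -
  have G: "br_refl_sum sc W \<mu> K K' = sum refl_term {s \<in> \<R>. s ` K' = K}" for K K'
    by (simp add: br_refl_sum_def refl_term_def)
  have fin: "finite M" by (simp add: M_def)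
  have "(\<Sum>K \<in> pencil Z - {H}. br_refl_sum sc W \<mu> H K) =
      (\<Sum>K \<in> pencil Z - {H}. sum refl_term {s \<in> M. inv_into UNIV s ` H = K})"
    unfolding G using mover_iff(2)[OF H] by (intro sum.cong refl) (auto simp: M_def)
  also have "\<dots> = sum refl_term M"
  proof (rule sum.group)
    have "inv_into UNIV s ` H \<noteq> H" if "s \<in> M" for s
    proof
      assume "inv_into UNIV s ` H = H"
      then have "s ` inv_into UNIV s ` H = s ` H" by (rule arg_cong)
      then show False using that by (simp add: M_def pencil_reflections_def)
    qed
    then show "(\<lambda>s. inv_into UNIV s ` H) ` M \<subseteq> pencil Z - {H}"
      using image_pencil(2) H by (auto simp: M_def pencil_reflections_def)
  qed (use fin in simp_all)
  finally show "(\<Sum>K \<in> pencil Z - {H}. br_refl_sum sc W \<mu> H K) = sum refl_term M" .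
  have "(\<Sum>K \<in> pencil Z - {H}. br_refl_sum sc W \<mu> K H) =
      (\<Sum>K \<in> pencil Z - {H}. sum refl_term {s \<in> M. s ` H = K})"
    unfolding G using mover_iff(1)[OF H] by (intro sum.cong refl) (auto simp: M_def)
  also have "\<dots> = sum refl_term M"
  proof (rule sum.group)
    show "(\<lambda>s. s ` H) ` M \<subseteq> pencil Z - {H}"
      using image_pencil(1) H by (auto simp: M_def pencil_reflections_def)
  qed (use fin in simp_all)
  finally show "(\<Sum>K \<in> pencil Z - {H}. br_refl_sum sc W \<mu> K H) = sum refl_term M" .
qed

text \<open>
  The commutators of \<open>e\<^sub>H\<close> with the other \<open>e\<^sub>K\<close> cancel against its commutators with the reflections
  moving \<open>H\<close>; the reflections stabilising \<open>H\<close> commute with \<open>e\<^sub>H\<close>.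
\<close>
lemma be_comm_pencil:
  assumes H: "H \<in> pencil Z"
  shows "commutes (be H) (pencil_residue Z)"
proof -
  have HH: "H \<in> \<H>" using H by (rule pencil_hyperplane)
  have e [simp]: "be H \<in> free_carrier S" using HH by simp
  define R where "R = pencil_reflections Z"
  define M where "M = {s \<in> R. s ` H \<noteq> H}"
  define N where "N = {s \<in> R. s ` H = H}"
  define F where "F = (\<Sum>K \<in> pencil Z. const (lam K) * bf (stab K))"
  define E where "E = (\<Sum>K \<in> pencil Z. be K)"
  have R: "s \<in> \<R>" if "s \<in> R" for s using that by (simp add: R_def pencil_reflections_def)
  have carr [simp]: "sum refl_term R \<in> free_carrier S" "sum refl_term M \<in> free_carrier S"
      "E \<in> free_carrier S" "F \<in> free_carrier S"
    using R unfolding M_def E_def F_def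
    by (auto intro!: free_carrier_sum free_carrier_mult simp: pencil_def)
  have "(\<Sum>K \<in> pencil Z. residue K) \<doteq> (\<Sum>K \<in> pencil Z. const (lam K) * bf (stab K) +
      (\<Sum>s \<in> {s \<in> \<R>. Fix s = K}. refl_term s) - be K)"
    by (intro cong_sum residue_expand) (simp add: pencil_def)
  also have "\<dots> = F + sum refl_term R - E"
    by (simp only: F_def E_def R_def refl_term_partition[symmetric] sum_subtractf sum.distrib)
  finally have T: "pencil_residue Z \<doteq> F + sum refl_term R - E"
    by (simp add: pencil_residue_def)
  have "commutes (be H) F"
    unfolding F_def
    by (intro commutes_sum commutes_mult commutes_const be_bf_comm) (auto simp: HH pencil_def)
  moreover have "commutes (be H) (sum refl_term R - E)"
  proof (rule commutesI)
    \<comment> \<open>The term \<open>K = H\<close> is a commutator of \<open>be H\<close> with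
      itself; dropping it leaves only pairs to which \<open>be_commutator\<close> applies.\<close>
    have "be H * E - E * be H = (\<Sum>K \<in> pencil Z - {H}. be H * be K - be K * be H)"
      using sum.remove[of "pencil Z" H "\<lambda>K. be H * be K - be K * be H"] H
      by (simp add: E_def sum_distrib_left sum_distrib_right sum_subtractf)
    also have "\<dots> \<doteq> (\<Sum>K \<in> pencil Z - {H}.
        be H * br_refl_sum sc W \<mu> H K - br_refl_sum sc W \<mu> K H * be H)"
      using HH by (intro cong_sum be_commutator) (auto simp: pencil_def)
    also have "\<dots> = be H * sum refl_term M - sum refl_term M * be H"
      unfolding sum_subtractf sum_distrib_left[symmetric] sum_distrib_right[symmetric]
        sum_movers[OF H] by (simp add: M_def R_def)
    finally have E: "be H * E - E * be H \<doteq> be H * sum refl_term M - sum refl_term M * be H" .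
    have N: "commutes (be H) (sum refl_term N)"
      using HH R by (intro commutes_sum refl_term_comm_be e) (auto simp: N_def)
    have RMN: "sum refl_term R = sum refl_term M + sum refl_term N"
      by (subst sum.union_disjoint[symmetric]) (auto simp: M_def N_def R_def intro!: sum.cong)
    have "be H * (sum refl_term R - E) - (sum refl_term R - E) * be H
        = (be H * sum refl_term R - sum refl_term R * be H) - (be H * E - E * be H)"
      by (simp add: algebra_simps)
    also have "\<dots> \<doteq> (be H * sum refl_term R - sum refl_term R * be H)
        - (be H * sum refl_term M - sum refl_term M * be H)"
      by (intro cong_diff[OF _ E] cong_refl free_carrier_diff free_carrier_mult) simp_all
    also have "\<dots> = be H * sum refl_term N - sum refl_term N * be H"
      unfolding RMN by (simp add: algebra_simps)
    also have "\<dots> \<doteq> 0" by (rule commutes_diff_0[OF N])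
    finally show "be H * (sum refl_term R - E) - (sum refl_term R - E) * be H \<doteq> 0" .
  qed simp_all
  ultimately have "commutes (be H) (F + (sum refl_term R - E))"
    by (rule commutes_add)
  then show ?thesis
    by (intro commutes_cong[OF _ T[THEN cong_sym]]) (simp add: add_diff_eq)
qed

text \<open>The factored form of the residue is used here: each of its factors is built from
  elements already known to commute with the pencil sum.\<close>

lemma residue_comm_pencil:
  assumes H: "H \<in> pencil Z"
  shows "commutes (residue H) (pencil_residue Z)"
proof -
  have HH: "H \<in> \<H>" using H by (rule pencil_hyperplane)
  have "commutes (pencil_residue Z) (refl_sum H)"
    unfolding refl_sum_def using H
    by (intro commutes_sum commutes_mult commutes_const bw_comm_pencil[THEN commutes_sym]) auto
  then have "commutes (pencil_residue Z) (residue H)"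
    unfolding residue_def
    by (intro commutes_mult commutes_diff commutes_add commutes_const pencil_residue_carrier
      bf_comm_pencil[THEN commutes_sym] be_comm_pencil[THEN commutes_sym] stab_in HH H)
  then show ?thesis by (rule commutes_sym)
qed

text \<open>A pointwise form of the Arnold relations. Once the forms of the pencil are scaled to
  take the value 1 at \<open>x\<close>, their coordinates with respect to \<open>\<alpha> H1\<close>
  and \<open>\<alpha> H2\<close> lie on an affine line, so the determinant of two of them is
  proportional to a difference of second coordinates.\<close>

lemma log_form_pencil:
  assumes H: "H1 \<in> \<H>" "H2 \<in> \<H>" and x: "x \<in> hyp_complement sc W"
  obtains D p where "\<And>H K. H \<in> pencil (H1 \<inter> H2) \<Longrightarrow> K \<in> pencil (H1 \<inter> H2) \<Longrightarrow>
    log_form (\<alpha> H) x u * log_form (\<alpha> K) x v - log_form (\<alpha> H) x v * log_form (\<alpha> K) x u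
      = D * (p K - p H)"
proof -
  have nz: "\<alpha> H x \<noteq> 0" if "H \<in> \<H>" for H
    using that x form_eq_0_iff by (auto simp: hyp_complement_def)
  have "\<exists>a b. \<forall>v. \<alpha> H v = a * \<alpha> H1 v + b * \<alpha> H2 v" if "H \<in> pencil (H1 \<inter> H2)" for H
  proof -
    have "H \<in> \<H>" "H1 \<inter> H2 \<subseteq> H" using that by (auto simp: pencil_def)
    then obtain a b where "\<And>v. \<alpha> H v = a * \<alpha> H1 v + b * \<alpha> H2 v"
      by (rule form_combination[OF assms(1,2)]) blast
    then show ?thesis by blast
  qed
  then obtain a b where ab:
    "\<And>H v. H \<in> pencil (H1 \<inter> H2) \<Longrightarrow> \<alpha> H v = a H * \<alpha> H1 v + b H * \<alpha> H2 v"
    by metis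
  define k where "k = 1 / (complex_of_real pi * \<i>)"
  have lf: "log_form \<beta> x w = k * (\<beta> w / \<beta> x)" for \<beta> :: "'v \<Rightarrow> complex" and w
    by (simp only: log_form_def k_def)
  \<comment> \<open>\<open>D\<close> gathers what does not depend on \<open>H\<close> and
    \<open>K\<close>; \<open>p H\<close> is the second coordinate of the form of \<open>H\<close>
    scaled to the value 1 at \<open>x\<close>.\<close>
  define D where "D = k\<^sup>2 * (\<alpha> H1 u * \<alpha> H2 v - \<alpha> H1 v * \<alpha> H2 u) / \<alpha> H1 x"
  define p where "p H = b H / \<alpha> H x" for H
  have "log_form (\<alpha> H) x u * log_form (\<alpha> K) x v - log_form (\<alpha> H) x v * log_form (\<alpha> K) x u
      = D * (p K - p H)"
    if "H \<in> pencil (H1 \<inter> H2)" "K \<in> pencil (H1 \<inter> H2)" for H K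
  proof -
    have nzs: "\<alpha> H1 x \<noteq> 0" "\<alpha> H x \<noteq> 0" "\<alpha> K x \<noteq> 0"
      using nz that H by (auto simp: pencil_def)
    have "b K * \<alpha> H x - b H * \<alpha> K x = \<alpha> H1 x * (a H * b K - b H * a K)"
      by (simp add: ab[OF that(1)] ab[OF that(2)] algebra_simps)
    then have pp: "p K - p H = \<alpha> H1 x * (a H * b K - b H * a K) / (\<alpha> H x * \<alpha> K x)"
      using nzs by (simp add: p_def diff_frac_eq mult.commute)
    have num: "\<alpha> H u * \<alpha> K v - \<alpha> H v * \<alpha> K u
        = (a H * b K - b H * a K) * (\<alpha> H1 u * \<alpha> H2 v - \<alpha> H1 v * \<alpha> H2 u)"
      by (simp add: ab[OF that(1)] ab[OF that(2)] algebra_simps)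
    have "log_form (\<alpha> H) x u * log_form (\<alpha> K) x v - log_form (\<alpha> H) x v * log_form (\<alpha> K) x u
        = k\<^sup>2 * ((\<alpha> H u * \<alpha> K v - \<alpha> H v * \<alpha> K u) / (\<alpha> H x * \<alpha> K x))"
      by (simp add: lf power2_eq_square diff_divide_distrib algebra_simps)
    also have "\<dots> = D * (p K - p H)"
      unfolding num pp D_def using nzs(1) by simp
    finally show ?thesis .
  qed
  then show ?thesis by (rule that)
qed

section \<open>The connection form on representatives: wedge square and equivariance\<close>

definition conn_rep :: "'v \<Rightarrow> 'v \<Rightarrow> 'v br_gen free_poly" where
  "conn_rep x v = (\<Sum>H \<in> \<H>. const (log_form (\<alpha> H) x v) * residue H)"

lemma conn_rep_carrier [simp]: "conn_rep x v \<in> free_carrier S"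
  unfolding conn_rep_def by (intro free_carrier_sum free_carrier_mult) auto

text \<open>By \<open>flat_eq\<close>, the distinct pairs with a prescribed intersection are all the
  distinct pairs of its pencil.\<close>

lemma pencil_pairs:
  assumes "H1 \<in> \<H>" "H2 \<in> \<H>" "H1 \<noteq> H2"
  shows "{(H, K). H \<in> \<H> \<and> K \<in> \<H> \<and> H \<noteq> K \<and> H \<inter> K = H1 \<inter> H2} =
    {(H, K). H \<in> pencil (H1 \<inter> H2) \<and> K \<in> pencil (H1 \<inter> H2) \<and> H \<noteq> K}"
  using flat_eq[OF assms(1,2)] by (auto simp: pencil_def)

lemma conn_rep_wedge:
  assumes x: "x \<in> hyp_complement sc W"
  shows "conn_rep x u * conn_rep x v - conn_rep x v * conn_rep x u \<doteq> 0"
proof -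
  define c where "c H K = log_form (\<alpha> H) x u * log_form (\<alpha> K) x v
      - log_form (\<alpha> H) x v * log_form (\<alpha> K) x u" for H K
  define q where "q = (\<lambda>(H, K). const (c H K) * (residue H * residue K))"
  define Pr where "Pr = {(H, K). H \<in> \<H> \<and> K \<in> \<H> \<and> H \<noteq> K}"
  have fin: "finite Pr" by (rule finite_subset[of _ "\<H> \<times> \<H>"]) (auto simp: Pr_def)
  have c_diag: "c H H = 0" for H by (simp add: c_def mult.commute)
  have "conn_rep x u * conn_rep x v - conn_rep x v * conn_rep x u
      = (\<Sum>H\<in>\<H>. \<Sum>K\<in>\<H>. q (H, K))"
    by (simp add: conn_rep_def sum_product sum_subtractf[symmetric] q_def c_def const_diff
        left_diff_distrib const_mult_const_mult)
  also have "\<dots> = sum q (\<H> \<times> \<H>)" by (simp add: sum.cartesian_product)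
  \<comment> \<open>Only distinct pairs have an intersection that determines a pencil as in
    \<open>pencil_pairs\<close>, so the vanishing diagonal terms are dropped before
    grouping.\<close>
  also have "\<dots> = sum q Pr"
    by (rule sum.mono_neutral_right) (auto simp: Pr_def q_def c_diag)
  also have "\<dots> = (\<Sum>Z \<in> (\<lambda>(H, K). H \<inter> K) ` Pr. sum q {y \<in> Pr. (\<lambda>(H, K). H \<inter> K) y = Z})"
    by (rule sum.image_gen[OF fin])
  also have "\<dots> \<doteq> (\<Sum>Z \<in> (\<lambda>(H, K). H \<inter> K) ` Pr. 0)"
  proof (rule cong_sum)
    fix Z assume "Z \<in> (\<lambda>(H, K). H \<inter> K) ` Pr"
    then obtain H1 H2 where H: "H1 \<in> \<H>" "H2 \<in> \<H>" "H1 \<noteq> H2" and Z: "Z = H1 \<inter> H2"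
      by (auto simp: Pr_def)
    obtain D p where Dp: "\<And>H K. H \<in> pencil Z \<Longrightarrow> K \<in> pencil Z \<Longrightarrow> c H K = D * (p K - p H)"
      using log_form_pencil[OF H(1,2) x] unfolding Z c_def by metis
    have "{y \<in> Pr. (\<lambda>(H, K). H \<inter> K) y = Z} = {(H, K). H \<in> pencil Z \<and> K \<in> pencil Z \<and> H \<noteq> K}"
      unfolding pencil_pairs[OF H, folded Z, symmetric] by (auto simp: Pr_def)
    \<comment> \<open>Putting the diagonal back turns the index set into a product, so that inner
      sums become \<open>pencil_residue Z\<close>.\<close>
    then have "sum q {y \<in> Pr. (\<lambda>(H, K). H \<inter> K) y = Z} = sum q (pencil Z \<times> pencil Z)"
      by (auto intro!: sum.mono_neutral_left simp: q_def c_diag)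
    also have "\<dots> = (\<Sum>H\<in>pencil Z. \<Sum>K\<in>pencil Z. const D * (const (p K) * (residue H * residue K))
        - const D * (const (p H) * (residue H * residue K)))"
      unfolding sum.cartesian_product
      by (intro sum.cong) (auto simp: q_def Dp const_mult const_diff algebra_simps)
    also have "\<dots> = (\<Sum>H\<in>pencil Z. \<Sum>K\<in>pencil Z. const D * (const (p K) * (residue H * residue K)))
        - (\<Sum>H\<in>pencil Z. \<Sum>K\<in>pencil Z. const D * (const (p H) * (residue H * residue K)))"
      by (simp add: sum_subtractf)
    \<comment> \<open>In the part with \<open>p K\<close> the sum over \<open>H\<close> is done
      first and puts the pencil sum on the left. In the part with \<open>p H\<close> the sum over
      \<open>K\<close> puts it on the right, and the remaining index is renamed.\<close>
    also have "(\<Sum>H\<in>pencil Z. \<Sum>K\<in>pencil Z. const D * (const (p K) * (residue H * residue K)))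
        = (\<Sum>K\<in>pencil Z. const D * (const (p K) * (pencil_residue Z * residue K)))"
      unfolding pencil_residue_def sum_distrib_left sum_distrib_right by (rule sum.swap)
    also have "(\<Sum>H\<in>pencil Z. \<Sum>K\<in>pencil Z. const D * (const (p H) * (residue H * residue K)))
        = (\<Sum>K\<in>pencil Z. const D * (const (p K) * (residue K * pencil_residue Z)))"
      unfolding pencil_residue_def sum_distrib_left sum_distrib_right by (rule refl)
    also have "(\<Sum>K\<in>pencil Z. const D * (const (p K) * (pencil_residue Z * residue K)))
        - (\<Sum>K\<in>pencil Z. const D * (const (p K) * (residue K * pencil_residue Z)))
        = (\<Sum>K\<in>pencil Z. const D * (const (p K) *
            (pencil_residue Z * residue K - residue K * pencil_residue Z)))"
      by (simp add: sum_subtractf[symmetric] right_diff_distrib)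
    also have "\<dots> \<doteq> (\<Sum>K\<in>pencil Z. const D * (const (p K) * 0))"
      by (intro cong_sum cong_mult_right free_carrier_const
        commutes_diff_0[OF residue_comm_pencil[THEN commutes_sym]])
    finally show "sum q {y \<in> Pr. (\<lambda>(H, K). H \<inter> K) y = Z} \<doteq> 0" by simp
  qed
  finally show ?thesis by simp
qed

text \<open>Pulling back the form of \<open>H\<close> along the inverse of \<open>w\<close> gives a
  form with the kernel of the one chosen for the image of \<open>H\<close>. The two differ by a
  nonzero scalar, which cancels in the logarithmic form.\<close>

lemma log_form_image:
  assumes "w \<in> W" "H \<in> \<H>"
  shows "log_form (\<alpha> H) (inv_into UNIV w x) (inv_into UNIV w v) = log_form (\<alpha> (w ` H)) x v"
proof -
  have wH: "w ` H \<in> \<H>" using assms by simp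
  have ker: "\<alpha> H (inv_into UNIV w y) = 0 \<longleftrightarrow> \<alpha> (w ` H) y = 0" for y
  proof -
    have "inv_into UNIV w y \<in> H \<longleftrightarrow> y \<in> w ` H"
    proof
      assume "inv_into UNIV w y \<in> H"
      then show "y \<in> w ` H"
        using assms(1) by (intro image_eqI[of _ _ "inv_into UNIV w y"]) auto
    qed (use assms(1) in auto)
    then show ?thesis by (simp add: form_eq_0_iff assms wH)
  qed
  have lin: "Vector_Spaces.linear sc (*) (\<lambda>y. \<alpha> H (inv_into UNIV w y))"
    using Vector_Spaces.linear_compose[OF W_linear[OF W_inv[OF assms(1)]] form_linear[OF assms(2)]]
    by (simp add: comp_def)
  obtain c where c: "\<And>y. \<alpha> H (inv_into UNIV w y) = c * \<alpha> (w ` H) y"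
    using V.linear_form_dependent[OF form_linear[OF wH] lin] ker by metis
  obtain y where "\<alpha> (w ` H) y \<noteq> 0"
    using hyperplane_proper[OF wH] form_eq_0_iff[OF wH] by blast
  then have "c \<noteq> 0" using ker[of y] c[of y] by auto
  then show ?thesis by (simp add: log_form_def c)
qed

lemma bij_betw_image_hyperplanes: "w \<in> W \<Longrightarrow> bij_betw ((`) w) \<H> \<H>"
  by (rule bij_betwI[where g = "(`) (inv_into UNIV w)"]) auto

lemma bw_inv: "w \<in> W \<Longrightarrow> bw w * bw (inv_into UNIV w) \<doteq> 1" "w \<in> W \<Longrightarrow> bw (inv_into UNIV w) * bw w \<doteq> 1"
  using rel(1)[of w "inv_into UNIV w"] rel(1)[of "inv_into UNIV w" w] rel(2)
  by (auto simp: W_inv_comp intro: cong_trans)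

text \<open>Both the logarithmic forms and the residues are carried from \<open>H\<close> to its
  image, and \<open>w\<close> permutes the hyperplanes.\<close>

lemma conn_rep_equivariant:
  assumes w: "w \<in> W"
  shows "bw w * conn_rep (inv_into UNIV w x) (inv_into UNIV w v) * bw (inv_into UNIV w) \<doteq> conn_rep x v"
proof -
  have "bw w * conn_rep (inv_into UNIV w x) (inv_into UNIV w v)
      = (\<Sum>H\<in>\<H>. const (log_form (\<alpha> (w ` H)) x v) * (bw w * residue H))"
    by (simp add: conn_rep_def sum_distrib_left const_left_commute log_form_image w)
  also have "\<dots> \<doteq> (\<Sum>H\<in>\<H>. const (log_form (\<alpha> (w ` H)) x v) * (residue (w ` H) * bw w))"
    by (intro cong_sum cong_mult_right bw_residue w) auto
  also have "\<dots> = conn_rep x v * bw w"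
    unfolding conn_rep_def sum_distrib_right mult.assoc
    by (rule sum.reindex_bij_betw[OF bij_betw_image_hyperplanes[OF w]])
  finally have "bw w * conn_rep (inv_into UNIV w x) (inv_into UNIV w v) * bw (inv_into UNIV w)
      \<doteq> conn_rep x v * bw w * bw (inv_into UNIV w)"
    using w by (intro cong_mult_left) auto
  also have "\<dots> \<doteq> conn_rep x v * 1"
    unfolding mult.assoc using w by (intro cong_mult_right bw_inv) auto
  finally show ?thesis by simp
qed

section \<open>Integrability and equivariance\<close>

abbreviation "A \<equiv> Br0 sc W \<L> \<mu>"
abbreviation "\<Omega> \<equiv> br_form sc W \<L> \<mu> lam \<alpha>"
abbreviation "X \<equiv> hyp_complement sc W"

lemma br_class_eq: "br_class sc W \<L> \<mu> = cl" "A = P"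
  by (auto simp: br_class_def Br0_def)

lemma br_form_om: "\<Omega> x v = cl (conn_rep x v)"
proof -
  have "cl (conn_rep x v) = (\<Oplus>\<^bsub>P\<^esub>H\<in>\<H>. cl (const (log_form (\<alpha> H) x v) * residue H))"
    unfolding conn_rep_def by (rule cl_sum) (auto intro: free_carrier_mult)
  also have "\<dots> = (\<Oplus>\<^bsub>P\<^esub>H\<in>\<H>. log_form (\<alpha> H) x v \<odot>\<^bsub>P\<^esub> cl (residue H))"
    by (intro P.finsum_cong') (auto simp: cl_smult intro!: cl_closed free_carrier_mult)
  finally show ?thesis
    by (simp add: br_form_def br_class_eq residue_def refl_sum_def)
qed

text \<open>Closedness is packaged with the tensor expression because \<open>has_ext_d\<close> asks
  for one expression whose scalar forms are differentiated.\<close>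

lemma br_form_tensor:
  "\<exists>n \<eta> a. is_tensor_sum sc X A n \<eta> a \<Omega> \<and> (\<forall>i<n. \<forall>x\<in>X. \<forall>u v. ext_d sc (\<eta> i) x u v = 0)"
proof -
  \<comment> \<open>\<open>is_tensor_sum\<close> is indexed by an initial segment of the naturals,
    so the hyperplanes are enumerated.\<close>
  obtain h where h: "bij_betw h {..<card \<H>} \<H>"
    using ex_bij_betw_nat_finite[of \<H>] by (auto simp: atLeast0LessThan)
  have h_in: "h i \<in> \<H>" if "i < card \<H>" for i
    using h that by (auto simp: bij_betw_def)
  have nz: "\<alpha> H x \<noteq> 0" if "H \<in> \<H>" "x \<in> X" for H x
    using that form_eq_0_iff by (auto simp: hyp_complement_def)
  define \<eta> where "\<eta> i = log_form (\<alpha> (h i))" for i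
  define a where "a i = cl (residue (h i))" for i
  have "is_tensor_sum sc X A (card \<H>) \<eta> a \<Omega>"
    unfolding is_tensor_sum_def
  proof (intro conjI allI impI ballI)
    fix i assume i: "i < card \<H>"
    show "\<eta> i \<in> forms1 sc X"
      unfolding \<eta>_def using h_in[OF i] nz by (intro log_form_in_forms1 form_linear) auto
    show "a i \<in> carrier A"
      unfolding a_def br_class_eq using h_in[OF i] by simp
  next
    fix x v assume "x \<in> X"
    have inj: "inj_on h {..<card \<H>}" and im: "h ` {..<card \<H>} = \<H>"
      using h by (auto simp: bij_betw_def)
    have "\<Omega> x v = (\<Oplus>\<^bsub>P\<^esub>H\<in>\<H>. log_form (\<alpha> H) x v \<odot>\<^bsub>P\<^esub> cl (residue H))"
      by (simp add: br_form_def br_class_eq residue_def refl_sum_def)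
    also have "\<dots> = (\<Oplus>\<^bsub>P\<^esub>i\<in>{..<card \<H>}. log_form (\<alpha> (h i)) x v \<odot>\<^bsub>P\<^esub> cl (residue (h i)))"
    proof -
      have "(\<lambda>H. log_form (\<alpha> H) x v \<odot>\<^bsub>P\<^esub> cl (residue H)) \<in> h ` {..<card \<H>} \<rightarrow> carrier P"
        unfolding im by (auto simp: cl_smult intro!: cl_closed free_carrier_mult)
      from P.finsum_reindex[OF this inj] show ?thesis unfolding im .
    qed
    finally show "\<Omega> x v = (\<Oplus>\<^bsub>A\<^esub>i\<in>{..<card \<H>}. \<eta> i x v \<odot>\<^bsub>A\<^esub> a i)"
      by (simp add: \<eta>_def a_def br_class_eq)
  qed
  moreover have "ext_d sc (\<eta> i) x u v = 0" if "i < card \<H>" "x \<in> X" for i x u v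
    unfolding \<eta>_def by (intro ext_d_log_form form_linear nz h_in that)
  ultimately show ?thesis by blast
qed

lemma br_form_in_tensor: "\<Omega> \<in> forms1_tensor sc X A"
  using br_form_tensor unfolding forms1_tensor_def by blast

lemma br_form_integrable: "integrable_form sc X A \<Omega>"
proof -
  obtain n \<eta> a where t: "is_tensor_sum sc X A n \<eta> a \<Omega>"
    and d: "\<And>i x u v. i < n \<Longrightarrow> x \<in> X \<Longrightarrow> ext_d sc (\<eta> i) x u v = 0"
    using br_form_tensor by blast
  have "(\<Oplus>\<^bsub>P\<^esub>i\<in>{..<n}. ext_d sc (\<eta> i) x u v \<odot>\<^bsub>P\<^esub> a i) = \<zero>\<^bsub>P\<^esub>" if "x \<in> X" for x u v
  proof -
    have "ext_d sc (\<eta> i) x u v \<odot>\<^bsub>P\<^esub> a i = \<zero>\<^bsub>P\<^esub>" if "i \<in> {..<n}" for i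
      using that d[of i x u v] \<open>x \<in> X\<close> t
      by (simp add: presented_algebra_sel(6) cl_0 is_tensor_sum_def br_class_eq)
    then have "(\<Oplus>\<^bsub>P\<^esub>i\<in>{..<n}. ext_d sc (\<eta> i) x u v \<odot>\<^bsub>P\<^esub> a i) = (\<Oplus>\<^bsub>P\<^esub>i\<in>{..<n}. \<zero>\<^bsub>P\<^esub>)"
      by (intro P.finsum_cong') auto
    then show ?thesis by simp
  qed
  \<comment> \<open>The exterior derivative may thus be taken to be zero, and integrability reduces
    to the vanishing of the wedge square.\<close>
  then have "has_ext_d sc X A \<Omega> (\<lambda>x u v. \<zero>\<^bsub>P\<^esub>)"
    unfolding has_ext_d_def using t
    by (intro exI[of _ n] exI[of _ \<eta>] exI[of _ a]) (auto simp: br_class_eq)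
  moreover have "\<zero>\<^bsub>P\<^esub> \<oplus>\<^bsub>A\<^esub> wedge A \<Omega> \<Omega> x u v = \<zero>\<^bsub>A\<^esub>" if "x \<in> X" for x u v
  proof -
    have "wedge A \<Omega> \<Omega> x u v = cl (conn_rep x u * conn_rep x v - conn_rep x v * conn_rep x u)"
      by (simp add: wedge_def br_form_om br_class_eq cl_mult cl_diff)
    also have "\<dots> = \<zero>\<^bsub>P\<^esub>"
      using conn_rep_wedge[OF that] by (simp add: cong_def cl_0)
    finally show ?thesis by (simp add: br_class_eq)
  qed
  ultimately show ?thesis unfolding integrable_form_def by blast
qed

lemma br_form_equivariant: "equivariant_form W X A (\<lambda>w. br_class sc W \<L> \<mu> (bw w)) \<Omega>"
  unfolding equivariant_form_def
proof (intro ballI allI)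
  fix w x v assume w: "w \<in> W"
  \<comment> \<open>The inverse in the algebra is the class of the inverse group element, so the
    diagonal action can be computed on representatives.\<close>
  have "inv\<^bsub>P\<^esub> (cl (bw w)) = cl (bw (inv_into UNIV w))"
    using bw_inv[OF w] w by (intro P.inv_unique'[symmetric]) (auto simp: cong_def cl_mult cl_1)
  then show "diag_action A (\<lambda>w. br_class sc W \<L> \<mu> (bw w)) w \<Omega> x v = \<Omega> x v"
    using conn_rep_equivariant[OF w, of x v] w
    by (simp add: diag_action_def br_form_om br_class_eq cl_mult cong_def)
qed

end

theorem theorem2p6:
  fixes sc :: "complex \<Rightarrow> 'v::ab_group_add \<Rightarrow> 'v"
    and Basis :: "'v set"
    and W :: "('v \<Rightarrow> 'v) set"
    and \<L> :: "('v \<Rightarrow> 'v) set set"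
    and \<mu> :: "('v \<Rightarrow> 'v) \<Rightarrow> complex"
    and lam :: "'v set \<Rightarrow> complex"
    and \<alpha> :: "'v set \<Rightarrow> 'v \<Rightarrow> complex"
  assumes "finite_dimensional_vector_space sc Basis"
    and "complex_reflection_group sc W"
    and "admissible_lattice sc W \<L>"
    and "\<forall>s \<in> reflections sc W. \<forall>w \<in> W. \<mu> (conj_map w s) = \<mu> s"
    and "\<forall>H \<in> hyperplanes sc W. \<forall>w \<in> W. lam (w ` H) = lam H"
    and "\<forall>H \<in> hyperplanes sc W. Vector_Spaces.linear sc (*) (\<alpha> H) \<and> {v. \<alpha> H v = 0} = H"
  shows "br_form sc W \<L> \<mu> lam \<alpha> \<in> forms1_tensor sc (hyp_complement sc W) (Br0 sc W \<L> \<mu>)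
    \<and> integrable_form sc (hyp_complement sc W) (Br0 sc W \<L> \<mu>) (br_form sc W \<L> \<mu> lam \<alpha>)
    \<and> equivariant_form W (hyp_complement sc W) (Br0 sc W \<L> \<mu>) (\<lambda>w. br_class sc W \<L> \<mu> (bw w))
        (br_form sc W \<L> \<mu> lam \<alpha>)"
proof -
  interpret brauer_connection sc Basis W \<alpha> \<L> \<mu> lam
    using assms
    by (intro brauer_connection.intro hyperplane_forms.intro linear_group.intro
        hyperplane_forms_axioms.intro brauer_connection_axioms.intro)
       (auto simp: complex_reflection_group_def reflection_subgroup_def)
  show ?thesis
    using br_form_in_tensor br_form_integrable br_form_equivariant by blast
qed

end
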